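(* Let $G=\mathrm{PSL}_2(\mathbf R)$. Let $X$ be a connected Hausdorff $G$-space equipped with a $G$-invariant probability measure $\mu$ of full support, and assume $(X,\mu)$ has the qualitative Sobolev embedding property. Then either $X$ is a point, or $X\cong\Gamma\backslash G$ as $G$-spaces for some cocompact lattice $\Gamma$ in $G$.
   Context: A $G$-space is a topological space $X$ with a $G$-action such that the action map $G\times X\to X$ is continuous. $(X,\mu)$ has the qualitative Sobolev embedding property if there exist $1\le p<q\le\infty$ and a nonnegative continuous function $\varphi\in L^1(G)$ (Haar measure), not identically zero, such that for every $f\in L^p(X,\mu)$ the convolution $\varphi*f(x)=\int_G\varphi(g)f(g^{-1}x)\,dg$ lies in $L^q(X,\mu)$. $\Gamma\backslash G$ carries the action of $G$ by right multiplication. *)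

theory Defs
  imports "HOL-Analysis.Analysis" "HOL-Probability.Probability"
begin

definition SL2 :: "(real^2^2) set" where
  "SL2 = {A. det A = 1}"

typedef psl2 = "{{A, - A} | A :: real^2^2. det A = 1}"
  by (rule exI[of _ "{mat 1, - mat 1}"]) (auto intro!: exI[of _ "mat 1"])

definition psl2_of :: "real^2^2 \<Rightarrow> psl2" where
  "psl2_of A = Abs_psl2 {A, - A}"

definition psl2_rep :: "psl2 \<Rightarrow> real^2^2" where
  "psl2_rep x = (SOME A. A \<in> Rep_psl2 x)"

instantiation psl2 :: "{times, one}"
begin
definition times_psl2 :: "psl2 \<Rightarrow> psl2 \<Rightarrow> psl2" where
  "x * y = psl2_of (psl2_rep x ** psl2_rep y)"
definition one_psl2 :: psl2 where
  "1 = psl2_of (mat 1)"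
instance ..
end

definition psl2_inv :: "psl2 \<Rightarrow> psl2" where
  "psl2_inv x = psl2_of (matrix_inv (psl2_rep x))"

instantiation psl2 :: topological_space
begin
definition open_psl2 :: "psl2 set \<Rightarrow> bool" where
  "open U \<longleftrightarrow> openin (top_of_set SL2) {A \<in> SL2. psl2_of A \<in> U}"
instance
proof
  show "open (UNIV :: psl2 set)"
    unfolding open_psl2_def by simp
next
  fix S T :: "psl2 set"
  assume "open S" "open T"
  then have "openin (top_of_set SL2) ({A \<in> SL2. psl2_of A \<in> S} \<inter> {A \<in> SL2. psl2_of A \<in> T})"
    unfolding open_psl2_def by (rule openin_Int)
  moreover have "{A \<in> SL2. psl2_of A \<in> S} \<inter> {A \<in> SL2. psl2_of A \<in> T} = {A \<in> SL2. psl2_of A \<in> S \<inter> T}"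
    by blast
  ultimately show "open (S \<inter> T)" unfolding open_psl2_def by simp
next
  fix K :: "psl2 set set"
  assume "\<forall>S\<in>K. open S"
  then have "openin (top_of_set SL2) (\<Union>S\<in>K. {A \<in> SL2. psl2_of A \<in> S})"
    unfolding open_psl2_def by (intro openin_Union) auto
  moreover have "(\<Union>S\<in>K. {A \<in> SL2. psl2_of A \<in> S}) = {A \<in> SL2. psl2_of A \<in> \<Union>K}"
    by blast
  ultimately show "open (\<Union>K)" unfolding open_psl2_def by simp
qed
end

definition G_space :: "(psl2 \<Rightarrow> 'x::topological_space \<Rightarrow> 'x) \<Rightarrow> bool" where
  "G_space act \<longleftrightarrow>
     continuous_on UNIV (\<lambda>(g, x). act g x) \<and>
     (\<forall>x. act 1 x = x) \<and>
     (\<forall>g h x. act (g * h) x = act g (act h x))"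

text \<open>Left Haar measure on G: nonzero, locally finite, left-invariant Borel measure
  (unique up to a positive scalar since G is second countable and locally compact).\<close>
definition haar_measure :: "psl2 measure \<Rightarrow> bool" where
  "haar_measure H \<longleftrightarrow>
     sets H = sets borel \<and>
     emeasure H UNIV \<noteq> 0 \<and>
     (\<forall>K. compact K \<longrightarrow> emeasure H K < \<infinity>) \<and>
     (\<forall>g A. A \<in> sets borel \<longrightarrow> emeasure H ((\<lambda>h. g * h) ` A) = emeasure H A)"

definition memLp :: "'a measure \<Rightarrow> ennreal \<Rightarrow> ('a \<Rightarrow> real) \<Rightarrow> bool" where
  "memLp M p f \<longleftrightarrow>
     f \<in> borel_measurable M \<and>
     (if p = \<infinity> then (\<exists>C. AE x in M. \<bar>f x\<bar> \<le> C)
      else (\<integral>\<^sup>+ x. ennreal (\<bar>f x\<bar> powr enn2real p) \<partial>M) < \<infinity>)"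

definition G_conv :: "psl2 measure \<Rightarrow> (psl2 \<Rightarrow> 'x \<Rightarrow> 'x) \<Rightarrow> (psl2 \<Rightarrow> real) \<Rightarrow> ('x \<Rightarrow> real) \<Rightarrow> 'x \<Rightarrow> real" where
  "G_conv H act \<phi> f x = (\<integral> g. \<phi> g * f (act (psl2_inv g) x) \<partial>H)"

definition qualitative_sobolev :: "(psl2 \<Rightarrow> 'x \<Rightarrow> 'x) \<Rightarrow> 'x measure \<Rightarrow> bool" where
  "qualitative_sobolev act \<mu> \<longleftrightarrow>
     (\<exists>H p q \<phi>. haar_measure H \<and> 1 \<le> p \<and> p < q \<and>
        continuous_on UNIV \<phi> \<and> (\<forall>g. 0 \<le> \<phi> g) \<and> integrable H \<phi> \<and> (\<exists>g. \<phi> g \<noteq> 0) \<and>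
        (\<forall>f. memLp \<mu> p f \<longrightarrow> memLp \<mu> q (G_conv H act \<phi> f)))"

definition psl2_rcoset :: "psl2 set \<Rightarrow> psl2 \<Rightarrow> psl2 set" where
  "psl2_rcoset \<Gamma> k = (\<lambda>\<gamma>. \<gamma> * k) ` \<Gamma>"

text \<open>A cocompact (uniform) lattice: a discrete subgroup \<Gamma> with \<Gamma>\G compact,
  i.e. G = \<Gamma>K for some compact K.\<close>
definition cocompact_lattice :: "psl2 set \<Rightarrow> bool" where
  "cocompact_lattice \<Gamma> \<longleftrightarrow>
     1 \<in> \<Gamma> \<and> (\<forall>a\<in>\<Gamma>. \<forall>b\<in>\<Gamma>. a * b \<in> \<Gamma>) \<and> (\<forall>a\<in>\<Gamma>. psl2_inv a \<in> \<Gamma>) \<and>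
     (\<exists>U. open U \<and> 1 \<in> U \<and> U \<inter> \<Gamma> = {1}) \<and>
     (\<exists>K. compact K \<and> (\<forall>g. \<exists>\<gamma>\<in>\<Gamma>. \<exists>c\<in>K. g = \<gamma> * c))"

text \<open>X is isomorphic as a G-space to \<Gamma>\G (G acting by right multiplication,
  g.(\<Gamma>k) = \<Gamma>kg^{-1}): there is F : G -> X inducing a homeomorphism
  \<Gamma>\G -> X (F is a quotient map whose fibres are exactly the cosets \<Gamma>k)
  which is equivariant.\<close>
definition iso_to_coset_space :: "psl2 set \<Rightarrow> (psl2 \<Rightarrow> 'x::topological_space \<Rightarrow> 'x) \<Rightarrow> bool" where
  "iso_to_coset_space \<Gamma> act \<longleftrightarrow>
     (\<exists>F :: psl2 \<Rightarrow> 'x.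
        quotient_map euclidean euclidean F \<and>
        (\<forall>k k'. F k = F k' \<longleftrightarrow> psl2_rcoset \<Gamma> k = psl2_rcoset \<Gamma> k') \<and>
        (\<forall>g k. F (k * psl2_inv g) = act g (F k)))"

end

theory Submission
  imports Defs
begin

text \<open>
  For each neighbourhood $V$ of the identity there is $c > 0$ with $\mu(VB) \ge c$ for all nonempty
  open $B$. Otherwise choose $B_n$ with $\mu(VB_n)$ decaying fast, and a relatively compact open $W$ on
  which $\varphi > 0$; then $A_n = W^{-1}VB_n$ is covered by boundedly many translates of $VB_n$, so
  $f = (\sum_n d_n 1_{A_n})^{1/p}$ lies in $L^p$ for suitable large $d_n$, while
  $\varphi * f \ge \kappa d_n^{1/p}$ on $VB_n$ keeps $\varphi * f$ out of $L^q$. So only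
  boundedly many sets $Vx_i$ can be disjoint, and every invariant open set is a finite
  union of compact pieces $V^{-1}Vx_i$. One of these pieces has interior, so some orbit is open; being
  itself such an invariant open set it is compact, and connectedness makes it all of $X$.

  It remains to see that a nondiscrete stabiliser is everything. By Poincare recurrence a stabiliser
  $\Gamma$ contains elements $u a^m v$ with $a = \mathrm{diag}(2, 1/2)$, $u, v$ near $1$ and $m$ large.
  Conjugating limit directions of $\Gamma$ at $1$ by such elements contracts them projectively to the
  nilpotent direction $E_{12}$; thus $\Gamma$, and likewise its conjugates, contain unipotent
  one-parameter groups, and these generate $\mathrm{SL}_2(\mathbf R)$.
\<close>

subsection \<open>Matrices and limit directions of subgroups\<close>

text \<open>The embedding hypothesis comes without a norm inequality, so the sets VB_n cannot be
  tested one at a time: a single function has to carry all of them. With heights d_n = 2^-n /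
  \<mu>(VB_n) its p-th power is integrable, while q > p makes d_n^(q/p) \<mu>(VB_n) exceed 2^n once
  \<mu>(VB_n) is small enough. The space is not assumed to be locally compact or second countable.
  But its covers by compact pieces are finite, and a finite closed cover of any space has a member
  with interior; this takes the place of Baire category, both for the open orbit and for the
  openness of orbit maps. That openness is what makes recurrence useful: a neighbourhood of x
  consists of points ux with u near 1, so a return under a^m becomes an exact stabiliser element
  after small corrections on both sides.\<close>

definition mat2 :: "real \<Rightarrow> real \<Rightarrow> real \<Rightarrow> real \<Rightarrow> real^2^2" where
  "mat2 a b c d = vector [vector [a, b], vector [c, d]]"

text \<open>The adjugate: it inverts elements of \<open>SL2\<close>, but is linear in the entries,
  hence continuous on all matrices and free of division.\<close>

definition adj2 :: "real^2^2 \<Rightarrow> real^2^2" where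
  "adj2 A = mat2 (A$2$2) (- A$1$2) (- A$2$1) (A$1$1)"

lemma mat2_nth [simp]:
  "mat2 a b c d $ 1 $ 1 = a" "mat2 a b c d $ 1 $ 2 = b"
  "mat2 a b c d $ 2 $ 1 = c" "mat2 a b c d $ 2 $ 2 = d"
  by (simp_all add: mat2_def)

lemma mat_1_nth [simp]:
  "(mat 1 :: real^2^2) $ 1 $ 1 = 1" "(mat 1 :: real^2^2) $ 1 $ 2 = 0"
  "(mat 1 :: real^2^2) $ 2 $ 1 = 0" "(mat 1 :: real^2^2) $ 2 $ 2 = 1"
  by (simp_all add: mat_def)

lemma matrix_mult_nth2 [simp]: "(A ** B) $ i $ j = A$i$1 * B$1$j + A$i$2 * B$2$j"
  for A B :: "real^2^2"
  by (simp add: matrix_matrix_mult_def sum_2)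

lemma matrix2_eq_iff: "A = B \<longleftrightarrow> A$1$1 = B$1$1 \<and> A$1$2 = B$1$2 \<and> A$2$1 = B$2$1 \<and> A$2$2 = B$2$2"
  for A B :: "real^2^2"
  by (auto simp: vec_eq_iff forall_2)

lemma SL2_iff: "A \<in> SL2 \<longleftrightarrow> A$1$1 * A$2$2 - A$1$2 * A$2$1 = 1"
  by (simp add: SL2_def det_2)

lemma adj2_nth [simp]:
  "adj2 A $ 1 $ 1 = A$2$2" "adj2 A $ 1 $ 2 = - A$1$2"
  "adj2 A $ 2 $ 1 = - A$2$1" "adj2 A $ 2 $ 2 = A$1$1"
  by (simp_all add: adj2_def)

lemma SL2_one [simp]: "mat 1 \<in> SL2"
  by (simp add: SL2_def)

lemma SL2_mult [simp]: "A \<in> SL2 \<Longrightarrow> B \<in> SL2 \<Longrightarrow> A ** B \<in> SL2"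
  by (simp add: SL2_def det_mul)

lemma SL2_adj2 [simp]: "A \<in> SL2 \<Longrightarrow> adj2 A \<in> SL2"
  by (simp add: SL2_iff algebra_simps)

lemma SL2_minus [simp]: "A \<in> SL2 \<Longrightarrow> - A \<in> SL2"
  by (simp add: SL2_iff)

lemma mult_adj2 [simp]: "A \<in> SL2 \<Longrightarrow> A ** adj2 A = mat 1"
  by (simp add: SL2_iff matrix2_eq_iff algebra_simps)

lemma adj2_mult [simp]: "A \<in> SL2 \<Longrightarrow> adj2 A ** A = mat 1"
  by (simp add: SL2_iff matrix2_eq_iff algebra_simps)

lemma adj2_adj2 [simp]: "adj2 (adj2 A) = A"
  by (simp add: matrix2_eq_iff)

lemma adj2_matrix_mult: "adj2 (A ** B) = adj2 B ** adj2 A"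
  by (simp add: matrix2_eq_iff algebra_simps)

lemma adj2_mat_1 [simp]: "adj2 (mat 1) = mat 1"
  by (simp add: matrix2_eq_iff)

lemma mult_adj2_cancel [simp]: "A \<in> SL2 \<Longrightarrow> A ** (adj2 A ** B) = B" "A \<in> SL2 \<Longrightarrow> adj2 A ** (A ** B) = B"
  by (simp_all add: matrix_mul_assoc)

lemma matrix_inv_SL2: "A \<in> SL2 \<Longrightarrow> matrix_inv A = adj2 A"
proof -
  assume A: "A \<in> SL2"
  then have "invertible A"
    unfolding invertible_def by (intro exI[of _ "adj2 A"]) simp
  then have "matrix_inv A ** A = mat 1"
    unfolding matrix_inv_def invertible_def by (rule someI2_ex) simp
  then have "matrix_inv A ** A ** adj2 A = adj2 A" by simp
  then show ?thesis using A by (simp add: matrix_mul_assoc[symmetric])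
qed

lemma tendsto_matrix2_iff:
  fixes f :: "'a \<Rightarrow> real^2^2"
  shows "(f \<longlongrightarrow> A) F \<longleftrightarrow>
    ((\<lambda>x. f x $ 1 $ 1) \<longlongrightarrow> A$1$1) F \<and> ((\<lambda>x. f x $ 1 $ 2) \<longlongrightarrow> A$1$2) F \<and>
    ((\<lambda>x. f x $ 2 $ 1) \<longlongrightarrow> A$2$1) F \<and> ((\<lambda>x. f x $ 2 $ 2) \<longlongrightarrow> A$2$2) F"
  (is "?L \<longleftrightarrow> ?R")
proof
  assume ?L then show ?R by (auto intro: tendsto_vec_nth)
next
  assume R: ?R
  have "((\<lambda>x. f x $ i $ j) \<longlongrightarrow> A $ i $ j) F" for i j
    using R exhaust_2[of i] exhaust_2[of j] by auto
  then show ?L by (intro vec_tendstoI)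
qed

lemma tendsto_matrix_mult [tendsto_intros]:
  fixes f g :: "'a \<Rightarrow> real^2^2"
  assumes "(f \<longlongrightarrow> A) F" "(g \<longlongrightarrow> B) F"
  shows "((\<lambda>x. f x ** g x) \<longlongrightarrow> A ** B) F"
  using assms unfolding tendsto_matrix2_iff by (auto intro!: tendsto_intros)

lemma tendsto_adj2 [tendsto_intros]:
  assumes "(f \<longlongrightarrow> A) F"
  shows "((\<lambda>x. adj2 (f x)) \<longlongrightarrow> adj2 A) F"
  using assms unfolding tendsto_matrix2_iff by (auto intro!: tendsto_intros)

lemma continuous_on_matrix_mult [continuous_intros]:
  fixes f g :: "'a::topological_space \<Rightarrow> real^2^2"
  shows "continuous_on S f \<Longrightarrow> continuous_on S g \<Longrightarrow> continuous_on S (\<lambda>x. f x ** g x)"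
  unfolding continuous_on_def by (auto intro: tendsto_matrix_mult)

lemma continuous_on_adj2 [continuous_intros]:
  "continuous_on S f \<Longrightarrow> continuous_on S (\<lambda>x. adj2 (f x))"
  unfolding continuous_on_def by (auto intro: tendsto_adj2)

lemma closed_SL2: "closed SL2"
proof -
  have "SL2 = (\<lambda>A::real^2^2. A$1$1 * A$2$2 - A$1$2 * A$2$1) -` {1}"
    by (auto simp: SL2_iff)
  moreover have "closed \<dots>"
    by (intro closed_vimage continuous_intros)
  ultimately show ?thesis by simp
qed

lemma matrix_scaleR_left2: "(s *\<^sub>R A) ** B = s *\<^sub>R (A ** B)"
  and matrix_scaleR_right2: "A ** (s *\<^sub>R B) = s *\<^sub>R (A ** B)" for A B :: "real^2^2"
  by (simp_all add: matrix2_eq_iff algebra_simps)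

section \<open>Limit directions at the identity\<close>

definition SL2_subgroup :: "(real^2^2) set \<Rightarrow> bool" where
  "SL2_subgroup \<Gamma> \<longleftrightarrow> \<Gamma> \<subseteq> SL2 \<and> mat 1 \<in> \<Gamma> \<and> (\<forall>A\<in>\<Gamma>. \<forall>B\<in>\<Gamma>. A ** B \<in> \<Gamma>) \<and> (\<forall>A\<in>\<Gamma>. adj2 A \<in> \<Gamma>)"

text \<open>Rescaled approaches to the identity within \<Gamma>. The factor \<open>s\<close> is
  positive, so this is a cone and not a priori a vector space; for a nonzero direction
  \<open>s\<close> is forced to tend to infinity.\<close>

definition tangent_cone :: "(real^2^2) set \<Rightarrow> (real^2^2) set" where
  "tangent_cone \<Gamma> = {X. \<forall>\<epsilon>>0. \<exists>\<gamma>\<in>\<Gamma>. \<exists>s>0. norm (\<gamma> - mat 1) < \<epsilon> \<and> norm (s *\<^sub>R (\<gamma> - mat 1) - X) < \<epsilon>}"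

lemma tangent_cone_iff_sequentially:
  "X \<in> tangent_cone \<Gamma> \<longleftrightarrow>
    (\<exists>\<gamma> s. (\<forall>n::nat. \<gamma> n \<in> \<Gamma> \<and> 0 < s n) \<and> \<gamma> \<longlonglongrightarrow> mat 1 \<and> (\<lambda>n. s n *\<^sub>R (\<gamma> n - mat 1)) \<longlonglongrightarrow> X)"
  (is "?L \<longleftrightarrow> ?R")
proof
  assume ?L
  then have "\<forall>n::nat. \<exists>\<gamma> s. \<gamma> \<in> \<Gamma> \<and> s > 0 \<and> norm (\<gamma> - mat 1) < 1 / real (Suc n) \<and>
      norm (s *\<^sub>R (\<gamma> - mat 1) - X) < 1 / real (Suc n)"
    unfolding tangent_cone_def mem_Collect_eq by (metis zero_less_divide_1_iff of_nat_0_less_iff zero_less_Suc)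
  then obtain \<gamma> s where g: "\<And>n::nat. \<gamma> n \<in> \<Gamma> \<and> (s n :: real) > 0 \<and> norm (\<gamma> n - mat 1) < 1 / real (Suc n) \<and>
      norm (s n *\<^sub>R (\<gamma> n - mat 1) - X) < 1 / real (Suc n)"
    by metis
  have lim: "(\<lambda>n. 1 / real (Suc n)) \<longlonglongrightarrow> 0"
    using LIMSEQ_inverse_real_of_nat by (simp add: inverse_eq_divide)
  have "\<gamma> \<longlonglongrightarrow> mat 1"
    by (rule LIM_zero_cancel, rule Lim_null_comparison[OF _ lim])
      (rule always_eventually, simp add: g less_imp_le del: of_nat_Suc)
  moreover have "(\<lambda>n. s n *\<^sub>R (\<gamma> n - mat 1)) \<longlonglongrightarrow> X"
    by (rule LIM_zero_cancel, rule Lim_null_comparison[OF _ lim])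
      (rule always_eventually, simp add: g less_imp_le del: of_nat_Suc)
  ultimately show ?R using g by blast
next
  assume ?R
  then obtain \<gamma> s where g: "\<And>n::nat. \<gamma> n \<in> \<Gamma>" "\<And>n. 0 < s n" and l1: "\<gamma> \<longlonglongrightarrow> mat 1"
    and l2: "(\<lambda>n. s n *\<^sub>R (\<gamma> n - mat 1)) \<longlonglongrightarrow> X" by blast
  show ?L unfolding tangent_cone_def
  proof (safe)
    fix \<epsilon> :: real assume e: "\<epsilon> > 0"
    have "eventually (\<lambda>n. dist (\<gamma> n) (mat 1) < \<epsilon> \<and> dist (s n *\<^sub>R (\<gamma> n - mat 1)) X < \<epsilon>) sequentially"
      using tendstoD[OF l1 e] tendstoD[OF l2 e] by (rule eventually_conj)
    then obtain n where "dist (\<gamma> n) (mat 1) < \<epsilon> \<and> dist (s n *\<^sub>R (\<gamma> n - mat 1)) X < \<epsilon>"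
      by (auto simp: eventually_sequentially)
    then show "\<exists>\<gamma>\<in>\<Gamma>. \<exists>s>0. norm (\<gamma> - mat 1) < \<epsilon> \<and> norm (s *\<^sub>R (\<gamma> - mat 1) - X) < \<epsilon>"
      using g by (auto simp: dist_norm)
  qed
qed

lemma closed_tangent_cone: "closed (tangent_cone \<Gamma>)"
  unfolding closed_sequential_limits
proof (intro allI impI, elim conjE)
  fix Z X assume Z: "\<forall>n. Z n \<in> tangent_cone \<Gamma>" and lim: "Z \<longlonglongrightarrow> X"
  show "X \<in> tangent_cone \<Gamma>" unfolding tangent_cone_def
  proof safe
    fix \<epsilon> :: real assume e: "\<epsilon> > 0"
    obtain n where n: "dist (Z n) X < \<epsilon>/2"
      using tendstoD[OF lim, of "\<epsilon>/2"] e by (auto simp: eventually_sequentially)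
    obtain \<gamma> s where g: "\<gamma> \<in> \<Gamma>" "s > 0" "norm (\<gamma> - mat 1) < \<epsilon>/2" "norm (s *\<^sub>R (\<gamma> - mat 1) - Z n) < \<epsilon>/2"
      using Z[rule_format, of n] e unfolding tangent_cone_def by (auto dest!: spec[of _ "\<epsilon>/2"])
    have "norm (s *\<^sub>R (\<gamma> - mat 1) - X) < \<epsilon>"
      using norm_diff_triangle_less[OF g(4) n[unfolded dist_norm]] by simp
    then show "\<exists>\<gamma>\<in>\<Gamma>. \<exists>s>0. norm (\<gamma> - mat 1) < \<epsilon> \<and> norm (s *\<^sub>R (\<gamma> - mat 1) - X) < \<epsilon>"
      using g e by (intro bexI[of _ \<gamma>] exI[of _ s]) auto
  qed
qed

lemma tangent_cone_scaleR:
  assumes "X \<in> tangent_cone \<Gamma>" "c > 0"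
  shows "c *\<^sub>R X \<in> tangent_cone \<Gamma>"
proof -
  obtain \<gamma> s where g: "\<And>n::nat. \<gamma> n \<in> \<Gamma>" "\<And>n. 0 < s n" and l1: "\<gamma> \<longlonglongrightarrow> mat 1"
    and l2: "(\<lambda>n. s n *\<^sub>R (\<gamma> n - mat 1)) \<longlonglongrightarrow> X"
    using assms(1) unfolding tangent_cone_iff_sequentially by blast
  have "(\<lambda>n. (c * s n) *\<^sub>R (\<gamma> n - mat 1)) \<longlonglongrightarrow> c *\<^sub>R X"
    using tendsto_scaleR[OF tendsto_const[of c] l2] by simp
  then show ?thesis unfolding tangent_cone_iff_sequentially
    using g l1 assms(2) by (intro exI[of _ \<gamma>] exI[of _ "\<lambda>n. c * s n"]) auto
qed

text \<open>Conjugation is linear and fixes \<open>mat 1\<close>, so it commutes with forming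
  s(\<gamma> - 1). Two sets occur because the result serves both conjugation within a subgroup and
  passage to a conjugate subgroup.\<close>

lemma tangent_cone_conjugate:
  assumes X: "X \<in> tangent_cone \<Gamma>" and h: "h \<in> SL2" and sub: "\<And>\<gamma>. \<gamma> \<in> \<Gamma> \<Longrightarrow> h ** \<gamma> ** adj2 h \<in> \<Gamma>'"
  shows "h ** X ** adj2 h \<in> tangent_cone \<Gamma>'"
proof -
  obtain \<gamma> s where g: "\<And>n::nat. \<gamma> n \<in> \<Gamma>" "\<And>n. 0 < s n" and l1: "\<gamma> \<longlonglongrightarrow> mat 1"
    and l2: "(\<lambda>n. s n *\<^sub>R (\<gamma> n - mat 1)) \<longlonglongrightarrow> X"
    using X unfolding tangent_cone_iff_sequentially by blast
  have one: "h ** mat 1 ** adj2 h = mat 1" using h by simp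
  have "(\<lambda>n. h ** \<gamma> n ** adj2 h) \<longlonglongrightarrow> h ** mat 1 ** adj2 h"
    by (intro tendsto_intros l1)
  moreover have eq: "s n *\<^sub>R (h ** \<gamma> n ** adj2 h - mat 1) = h ** (s n *\<^sub>R (\<gamma> n - mat 1)) ** adj2 h" for n
  proof -
    have "s n *\<^sub>R (h ** \<gamma> n ** adj2 h - h ** mat 1 ** adj2 h) = h ** (s n *\<^sub>R (\<gamma> n - mat 1)) ** adj2 h"
      unfolding matrix2_eq_iff by (simp add: algebra_simps)
    then show ?thesis using one by simp
  qed
  have "(\<lambda>n. s n *\<^sub>R (h ** \<gamma> n ** adj2 h - mat 1)) \<longlonglongrightarrow> h ** X ** adj2 h"
    unfolding eq by (intro tendsto_intros l2)
  ultimately show ?thesis unfolding tangent_cone_iff_sequentially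
    using g sub one by (intro exI[of _ "\<lambda>n. h ** \<gamma> n ** adj2 h"] exI[of _ s]) auto
qed

section \<open>Operator norms, matrix powers and unipotent limits\<close>

text \<open>The operator norm gives the identity norm at most 1, so powers of order s of a matrix 1
  + O(1/s) stay bounded. The Euclidean norm of \<open>mat 1\<close> is sqrt 2.\<close>

lemma onorm_matrix_mult_le: "onorm ((*v) (A ** B)) \<le> onorm ((*v) A) * onorm ((*v) B)" for A B :: "real^2^2"
proof -
  have "(*v) (A ** B) = (*v) A \<circ> (*v) B" by (auto simp: matrix_vector_mul_assoc)
  then show ?thesis
    using onorm_compose[OF matrix_vector_mul_bounded_linear matrix_vector_mul_bounded_linear, of A B] by simp
qed

lemma onorm_matrix_add_le: "onorm ((*v) (A + B)) \<le> onorm ((*v) A) + onorm ((*v) B)" for A B :: "real^2^2"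
proof -
  have "(*v) (A + B) = (\<lambda>x. A *v x + B *v x)" by (auto simp: matrix_vector_mult_add_rdistrib)
  then show ?thesis
    using onorm_triangle[OF matrix_vector_mul_bounded_linear matrix_vector_mul_bounded_linear, of A B] by simp
qed

lemma onorm_matrix_nonneg: "0 \<le> onorm ((*v) A)" for A :: "real^2^2"
  by (rule onorm_pos_le) (rule matrix_vector_mul_bounded_linear)

lemma onorm_matrix_one_le: "onorm ((*v) (mat 1 :: real^2^2)) \<le> 1"
  by (rule onorm_le) simp

lemma onorm_matrix_scaleR: "onorm ((*v) (c *\<^sub>R A)) = \<bar>c\<bar> * onorm ((*v) A)" for A :: "real^2^2"
proof -
  have "(*v) (c *\<^sub>R A) = (\<lambda>x. c *\<^sub>R (A *v x))" by (auto simp: scaleR_matrix_vector_assoc)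
  then show ?thesis using onorm_scaleR[OF matrix_vector_mul_bounded_linear, of c A] by simp
qed

lemma tendsto_onorm_zero:
  fixes f :: "nat \<Rightarrow> real^2^2"
  assumes "f \<longlonglongrightarrow> 0"
  shows "(\<lambda>n. onorm ((*v) (f n))) \<longlonglongrightarrow> 0"
proof (rule Lim_null_comparison)
  show "\<forall>\<^sub>F n in sequentially. norm (onorm ((*v) (f n))) \<le> (\<Sum>i\<in>UNIV. \<Sum>j\<in>UNIV. \<bar>f n $ i $ j\<bar>)"
    by (simp add: onorm_matrix_nonneg onorm_le_matrix_component_sum)
  have "(\<lambda>n. \<Sum>i\<in>UNIV. \<Sum>j\<in>UNIV. \<bar>f n $ i $ j\<bar>) \<longlonglongrightarrow> (\<Sum>i\<in>(UNIV::2 set). \<Sum>j\<in>(UNIV::2 set). \<bar>(0::real^2^2) $ i $ j\<bar>)"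
    by (intro tendsto_intros assms)
  then show "(\<lambda>n. \<Sum>i\<in>UNIV. \<Sum>j\<in>UNIV. \<bar>f n $ i $ j\<bar>) \<longlonglongrightarrow> 0" by simp
qed

lemma onorm_tendsto_zero_imp:
  fixes f :: "nat \<Rightarrow> real^2^2"
  assumes "(\<lambda>n. onorm ((*v) (f n))) \<longlonglongrightarrow> 0"
  shows "f \<longlonglongrightarrow> 0"
proof -
  have "(\<lambda>n. f n $ i $ j) \<longlonglongrightarrow> 0" for i j
    by (rule Lim_null_comparison[OF _ assms]) (simp add: matrix_component_le_onorm)
  then show ?thesis by (simp add: tendsto_matrix2_iff)
qed

definition matpow :: "real^2^2 \<Rightarrow> nat \<Rightarrow> real^2^2" where
  "matpow A k = ((**) A ^^ k) (mat 1)"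

lemma matpow_simps [simp]: "matpow A 0 = mat 1" "matpow A (Suc k) = A ** matpow A k"
  by (simp_all add: matpow_def)

lemma onorm_matpow_le:
  assumes "onorm ((*v) A) \<le> M"
  shows "onorm ((*v) (matpow A k)) \<le> M ^ k"
proof (induction k)
  case 0 show ?case using onorm_matrix_one_le by (simp del: matrix_vector_mul_lid)
next
  case (Suc k)
  have "onorm ((*v) (matpow A (Suc k))) \<le> onorm ((*v) A) * onorm ((*v) (matpow A k))"
    by (simp add: onorm_matrix_mult_le)
  also have "\<dots> \<le> M * M ^ k"
    using assms Suc onorm_matrix_nonneg by (intro mult_mono) (auto intro: order_trans)
  finally show ?case by simp
qed

text \<open>Telescoping. The factor \<open>k\<close> is harmless in the application, where A and B
  differ by o(1/s) and k is at most t s.\<close>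

lemma onorm_matpow_diff_le:
  assumes "onorm ((*v) A) \<le> M" "onorm ((*v) B) \<le> M" "1 \<le> M"
  shows "onorm ((*v) (matpow A k - matpow B k)) \<le> real k * M ^ k * onorm ((*v) (A - B))"
proof (induction k)
  case 0
  have "(*v) (0::real^2^2) = (\<lambda>x. 0)" by auto
  then show ?case by (simp add: onorm_zero)
next
  case (Suc k)
  let ?N = "\<lambda>A::real^2^2. onorm ((*v) A)"
  have "matpow A (Suc k) - matpow B (Suc k) = A ** (matpow A k - matpow B k) + (A - B) ** matpow B k"
    unfolding matrix2_eq_iff by (simp add: algebra_simps)
  then have "?N (matpow A (Suc k) - matpow B (Suc k)) \<le> ?N A * ?N (matpow A k - matpow B k) + ?N (A - B) * ?N (matpow B k)"
    using onorm_matrix_add_le[of "A ** (matpow A k - matpow B k)" "(A - B) ** matpow B k"]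
      onorm_matrix_mult_le[of A "matpow A k - matpow B k"] onorm_matrix_mult_le[of "A - B" "matpow B k"]
    by (simp only:)
  also have "\<dots> \<le> M * (real k * M ^ k * ?N (A - B)) + ?N (A - B) * M ^ k"
    using assms Suc onorm_matrix_nonneg onorm_matpow_le[OF assms(2)]
    by (intro add_mono mult_mono mult_left_mono) auto
  also have "\<dots> \<le> M * (real k * M ^ k * ?N (A - B)) + ?N (A - B) * M ^ Suc k"
    using assms(3) onorm_matrix_nonneg by (intro add_left_mono mult_left_mono) auto
  also have "\<dots> = real (Suc k) * M ^ Suc k * ?N (A - B)" by (simp add: algebra_simps)
  finally show ?case .
qed

lemma matpow_unipotent: "matpow (mat2 1 x 0 1) k = mat2 1 (real k * x) 0 1"
  by (induction k) (simp_all add: matrix2_eq_iff algebra_simps)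

text \<open>Powers of \<gamma>_n with exponent about t s_n follow the one-parameter group: 1 + E/s_n
  has explicit powers because E is nilpotent, \<gamma>_n differs from it by o(1/s_n), and closedness
  puts the limit into \<Gamma>.\<close>

lemma unipotent_mem_of_tangent:
  assumes G: "SL2_subgroup \<Gamma>" "closed \<Gamma>" and E: "mat2 0 e 0 0 \<in> tangent_cone \<Gamma>" and t: "t \<ge> 0"
  shows "mat2 1 (t * e) 0 1 \<in> \<Gamma>"
proof (cases "e = 0")
  case True
  have "mat2 1 (t * e) 0 1 = mat 1" using True by (simp add: matrix2_eq_iff)
  then show ?thesis using G by (simp add: SL2_subgroup_def)
next
  case False
  let ?N = "\<lambda>A::real^2^2. onorm ((*v) A)"
  define E where "E = mat2 0 e 0 0"
  obtain \<gamma> s where g: "\<And>n::nat. \<gamma> n \<in> \<Gamma>" "\<And>n. 0 < s n" and l1: "\<gamma> \<longlonglongrightarrow> mat 1"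
    and l2: "(\<lambda>n. s n *\<^sub>R (\<gamma> n - mat 1)) \<longlonglongrightarrow> E"
    using E unfolding tangent_cone_iff_sequentially E_def by blast
  define Z where "Z n = \<gamma> n - mat 1" for n
  have Z0: "Z \<longlonglongrightarrow> 0" using l1 unfolding Z_def by (simp add: LIM_zero_iff)
  have sZ: "(\<lambda>n. s n *\<^sub>R Z n - E) \<longlonglongrightarrow> 0" using l2 unfolding Z_def by (simp add: LIM_zero_iff)
  \<comment> \<open>Here e \<noteq> 0 enters: the upper right entry of \<open>Z n\<close> tends to 0
    but tends to e after scaling, so \<open>s n\<close> must diverge.\<close>
  have s0: "(\<lambda>n. 1 / s n) \<longlonglongrightarrow> 0"
  proof -
    have a: "(\<lambda>n. Z n $ 1 $ 2) \<longlonglongrightarrow> 0" using Z0 by (simp add: tendsto_matrix2_iff)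
    have b: "(\<lambda>n. s n * Z n $ 1 $ 2) \<longlonglongrightarrow> e"
      using l2 by (simp add: tendsto_matrix2_iff E_def Z_def)
    have "(\<lambda>n. Z n $ 1 $ 2 / (s n * Z n $ 1 $ 2)) \<longlonglongrightarrow> 0 / e"
      by (intro tendsto_divide a b False)
    moreover have "eventually (\<lambda>n. s n * Z n $ 1 $ 2 \<noteq> 0) sequentially"
      using tendsto_imp_eventually_ne[OF b False] .
    ultimately show ?thesis
      by (auto elim!: Lim_transform_eventually eventually_mono simp: field_simps)
  qed
  \<comment> \<open>Rounding down changes k n / s n by at most 1 / s n, which vanishes in the
    limit.\<close>
  define k where "k n = nat \<lfloor>t * s n\<rfloor>" for n
  have kle: "real (k n) \<le> t * s n" and kge: "t * s n - 1 \<le> real (k n)" for n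
    using t g(2)[of n] by (auto simp: k_def)
  have kle': "real (k n) / s n \<le> t" for n using kle[of n] g(2)[of n] by (simp add: field_simps)
  have klim: "(\<lambda>n. real (k n) / s n) \<longlonglongrightarrow> t"
  proof (rule tendsto_sandwich[OF _ _ _ tendsto_const[of t]])
    show "(\<lambda>n. t - 1 / s n) \<longlonglongrightarrow> t" using tendsto_diff[OF tendsto_const[of t] s0] by simp
    show "\<forall>\<^sub>F n in sequentially. t - 1 / s n \<le> real (k n) / s n"
    proof (intro always_eventually allI)
      fix n show "t - 1 / s n \<le> real (k n) / s n"
        using divide_right_mono[OF kge[of n], of "s n"] g(2)[of n] by (simp add: diff_divide_distrib)
    qed
  qed (simp add: kle')
  define B where "B n = mat2 1 (e / s n) 0 1" for n
  have Beq: "B n = mat 1 + (1 / s n) *\<^sub>R E" for n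
    by (simp add: B_def E_def matrix2_eq_iff)
  have Bpow: "matpow (B n) (k n) = mat2 1 (real (k n) / s n * e) 0 1" for n
    by (simp add: B_def matpow_unipotent)
  \<comment> \<open>One constant for both sequences, so that \<open>\<gamma> n\<close> and
    \<open>B n\<close> both have norm at most 1 + C / s n.\<close>
  obtain C where C: "C \<ge> 0" "\<And>n. ?N (s n *\<^sub>R Z n) \<le> C" "?N E \<le> C"
  proof -
    obtain K where K: "\<And>n. norm (?N (s n *\<^sub>R Z n - E)) \<le> K"
      using convergent_imp_Bseq[OF convergentI[OF tendsto_onorm_zero[OF sZ]]] by (auto simp: Bseq_def)
    have "?N (s n *\<^sub>R Z n) \<le> K + ?N E" for n
      using onorm_matrix_add_le[of "s n *\<^sub>R Z n - E" E] K[of n] by simp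
    moreover have "K \<ge> 0" using K[of 0] by (meson norm_ge_zero order_trans)
    ultimately show ?thesis using that[of "K + ?N E"] onorm_matrix_nonneg[of E] by simp
  qed
  have bound: "?N (matpow (\<gamma> n) (k n) - matpow (B n) (k n)) \<le> t * exp (C * t) * ?N (s n *\<^sub>R Z n - E)" for n
  proof -
    define M where "M = 1 + C / s n"
    have sn: "s n > 0" by (rule g)
    have gZ: "\<gamma> n = mat 1 + (1 / s n) *\<^sub>R (s n *\<^sub>R Z n)" using sn by (simp add: Z_def)
    have A: "?N (\<gamma> n) \<le> M"
    proof -
      have "?N (\<gamma> n) \<le> 1 + (1 / s n) * ?N (s n *\<^sub>R Z n)"
        using onorm_matrix_add_le[of "mat 1" "(1 / s n) *\<^sub>R (s n *\<^sub>R Z n)"] onorm_matrix_one_le sn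
        unfolding gZ[symmetric] onorm_matrix_scaleR[of "1 / s n"] by simp
      also have "\<dots> \<le> M" unfolding M_def using C(2)[of n] sn by (simp add: divide_right_mono)
      finally show ?thesis .
    qed
    have A': "?N (B n) \<le> M"
    proof -
      have "?N (B n) \<le> 1 + (1 / s n) * ?N E"
        using onorm_matrix_add_le[of "mat 1" "(1 / s n) *\<^sub>R E"] onorm_matrix_one_le sn
        unfolding Beq onorm_matrix_scaleR[of "1 / s n"] by simp
      also have "\<dots> \<le> M" unfolding M_def using C(3) sn by (simp add: divide_right_mono)
      finally show ?thesis .
    qed
    have M1: "1 \<le> M" unfolding M_def using C(1) sn by simp
    have diff: "?N (\<gamma> n - B n) = ?N (s n *\<^sub>R Z n - E) / s n"
    proof -
      have "\<gamma> n - B n = (1 / s n) *\<^sub>R (s n *\<^sub>R Z n - E)"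
        using sn by (simp add: Beq Z_def algebra_simps)
      then show ?thesis using sn by (simp add: onorm_matrix_scaleR)
    qed
    \<comment> \<open>(1 + C/s)^k is at most exp(C k/s), and k/s \<le> t.\<close>
    have Mk: "M ^ k n \<le> exp (C * t)"
    proof -
      have "M ^ k n \<le> exp (C / s n) ^ k n"
        unfolding M_def using C(1) sn by (intro power_mono exp_ge_add_one_self) auto
      also have "\<dots> = exp (C * (real (k n) / s n))" by (simp add: exp_of_nat_mult[symmetric])
      also have "\<dots> \<le> exp (C * t)" using mult_left_mono[OF kle'[of n] C(1)] by simp
      finally show ?thesis .
    qed
    have "?N (matpow (\<gamma> n) (k n) - matpow (B n) (k n)) \<le> real (k n) * M ^ k n * ?N (\<gamma> n - B n)"
      by (rule onorm_matpow_diff_le[OF A A' M1])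
    also have "\<dots> = (real (k n) / s n) * M ^ k n * ?N (s n *\<^sub>R Z n - E)" by (simp add: diff)
    also have "\<dots> \<le> t * exp (C * t) * ?N (s n *\<^sub>R Z n - E)"
      using kle'[of n] Mk M1 t sn onorm_matrix_nonneg by (intro mult_right_mono mult_mono) auto
    finally show ?thesis .
  qed
  have "(\<lambda>n. ?N (matpow (\<gamma> n) (k n) - matpow (B n) (k n))) \<longlonglongrightarrow> 0"
  proof (rule Lim_null_comparison)
    show "\<forall>\<^sub>F n in sequentially. norm (?N (matpow (\<gamma> n) (k n) - matpow (B n) (k n))) \<le> t * exp (C * t) * ?N (s n *\<^sub>R Z n - E)"
      using bound by (simp add: onorm_matrix_nonneg)
    show "(\<lambda>n. t * exp (C * t) * ?N (s n *\<^sub>R Z n - E)) \<longlonglongrightarrow> 0"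
      using tendsto_mult[OF tendsto_const tendsto_onorm_zero[OF sZ]] by simp
  qed
  then have d0: "(\<lambda>n. matpow (\<gamma> n) (k n) - matpow (B n) (k n)) \<longlonglongrightarrow> 0"
    by (rule onorm_tendsto_zero_imp)
  have "(\<lambda>n. matpow (B n) (k n)) \<longlonglongrightarrow> mat2 1 (t * e) 0 1"
    unfolding Bpow using tendsto_mult[OF klim tendsto_const[of e]] by (simp add: tendsto_matrix2_iff)
  from tendsto_add[OF d0 this] have lim: "(\<lambda>n. matpow (\<gamma> n) (k n)) \<longlonglongrightarrow> mat2 1 (t * e) 0 1" by simp
  have "matpow A j \<in> \<Gamma>" if "A \<in> \<Gamma>" for A j
    using that G(1) by (induction j) (auto simp: SL2_subgroup_def)
  then have "matpow (\<gamma> n) (k n) \<in> \<Gamma>" for n using g by simp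
  then show ?thesis using G(2) lim by (meson closed_sequentially)
qed

section \<open>Expansion along the diagonal and conjugate subgroups\<close>

text \<open>What recurrence under diag(2, 1/2) will give for stabilisers, stated for matrices alone.
  The corrections \<open>u\<close> and \<open>v\<close> are independent of each other, and
  \<open>m\<close> is arbitrarily large.\<close>

definition recurrent_along_diagonal :: "(real^2^2) set \<Rightarrow> bool" where
  "recurrent_along_diagonal \<Gamma> \<longleftrightarrow> (\<forall>\<epsilon>>0. \<forall>N. \<exists>u\<in>SL2. \<exists>v\<in>SL2. \<exists>m\<ge>N.
     norm (u - mat 1) < \<epsilon> \<and> norm (v - mat 1) < \<epsilon> \<and> u ** mat2 (2 ^ m) 0 0 (1 / 2 ^ m) ** v \<in> \<Gamma>)"

text \<open>Conjugation by a^m multiplies the upper right entry by 4^m, fixes the diagonal and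
  divides the lower left entry by 4^m. The cone absorbs a factor 4^-m, and closedness gives the
  limit because u and v tend to 1.\<close>

lemma tangent_cone_expand:
  assumes G: "SL2_subgroup \<Gamma>" and rec: "recurrent_along_diagonal \<Gamma>" and X: "X \<in> tangent_cone \<Gamma>"
  shows "mat2 0 (X$1$2) 0 0 \<in> tangent_cone \<Gamma>"
proof -
  have "\<forall>n::nat. \<exists>u v m. u \<in> SL2 \<and> v \<in> SL2 \<and> n \<le> m \<and> norm (u - mat 1) < 1 / real (Suc n) \<and>
      norm (v - mat 1) < 1 / real (Suc n) \<and> u ** mat2 (2 ^ m) 0 0 (1 / 2 ^ m) ** v \<in> \<Gamma>"
    using rec unfolding recurrent_along_diagonal_def
    by (metis zero_less_divide_1_iff of_nat_0_less_iff zero_less_Suc)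
  then obtain u v m where uv: "\<And>n::nat. u n \<in> SL2" "\<And>n. v n \<in> SL2" "\<And>n. n \<le> m n"
    and un: "\<And>n. norm (u n - mat 1) < 1 / real (Suc n)" and vn: "\<And>n. norm (v n - mat 1) < 1 / real (Suc n)"
    and mem: "\<And>n. u n ** mat2 (2 ^ m n) 0 0 (1 / 2 ^ m n) ** v n \<in> \<Gamma>"
    by metis
  have lim: "(\<lambda>n. 1 / real (Suc n)) \<longlonglongrightarrow> 0"
    using LIMSEQ_inverse_real_of_nat by (simp add: inverse_eq_divide)
  have ulim: "u \<longlonglongrightarrow> mat 1"
    by (rule LIM_zero_cancel, rule Lim_null_comparison[OF _ lim])
      (rule always_eventually, simp add: un less_imp_le del: of_nat_Suc)
  have vlim: "v \<longlonglongrightarrow> mat 1"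
    by (rule LIM_zero_cancel, rule Lim_null_comparison[OF _ lim])
      (rule always_eventually, simp add: vn less_imp_le del: of_nat_Suc)
  have mlim: "(\<lambda>n. c ^ m n) \<longlonglongrightarrow> 0" if "0 < c" "c < 1" for c :: real
  proof (rule Lim_null_comparison)
    show "\<forall>\<^sub>F n in sequentially. norm (c ^ m n) \<le> c ^ n"
      using that uv(3) by (simp add: power_decreasing)
    show "(\<lambda>n. c ^ n) \<longlonglongrightarrow> 0" using that by (intro LIMSEQ_power_zero) auto
  qed
  define Y where "Y n = v n ** X ** adj2 (v n)" for n
  have "Y \<longlonglongrightarrow> mat 1 ** X ** adj2 (mat 1)"
    unfolding Y_def by (intro tendsto_intros vlim)
  then have Ylim: "Y \<longlonglongrightarrow> X" by simp
  then have Yl: "(\<lambda>n. Y n $ 1 $ 1) \<longlonglongrightarrow> X$1$1" "(\<lambda>n. Y n $ 1 $ 2) \<longlonglongrightarrow> X$1$2"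
      "(\<lambda>n. Y n $ 2 $ 1) \<longlonglongrightarrow> X$2$1" "(\<lambda>n. Y n $ 2 $ 2) \<longlonglongrightarrow> X$2$2"
    by (simp_all only: tendsto_matrix2_iff)
  \<comment> \<open>This is 4^-m times a^m Y a^-m, so the entries carry the weights 4^-m, 1, 16^-m,
    4^-m.\<close>
  define D where "D n = mat2 (Y n $ 1 $ 1 * (1/4) ^ m n) (Y n $ 1 $ 2) (Y n $ 2 $ 1 * (1/16) ^ m n) (Y n $ 2 $ 2 * (1/4) ^ m n)" for n
  have Dlim: "D \<longlonglongrightarrow> mat2 0 (X$1$2) 0 0"
    unfolding D_def tendsto_matrix2_iff
    using tendsto_mult[OF Yl(1) mlim[of "1/4"]] tendsto_mult[OF Yl(3) mlim[of "1/16"]] tendsto_mult[OF Yl(4) mlim[of "1/4"]] Yl(2)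
    by simp
  define \<delta> where "\<delta> n = u n ** mat2 (2 ^ m n) 0 0 (1 / 2 ^ m n) ** v n" for n
  have eq: "(1 / 4 ^ m n) *\<^sub>R (\<delta> n ** X ** adj2 (\<delta> n)) = u n ** D n ** adj2 (u n)" for n
  proof -
    let ?a = "mat2 (2 ^ m n) 0 0 (1 / 2 ^ m n)"
    have p: "(4::real) ^ m n = 2 ^ m n * 2 ^ m n" "(16::real) ^ m n = 2 ^ m n * 2 ^ m n * (2 ^ m n * 2 ^ m n)"
      by (simp_all add: power_mult_distrib[symmetric])
    have "(1 / 4 ^ m n) *\<^sub>R (?a ** Y n ** adj2 ?a) = D n"
      unfolding D_def matrix2_eq_iff by (simp add: p power_divide field_simps)
    then have "u n ** D n ** adj2 (u n) = (1 / 4 ^ m n) *\<^sub>R (u n ** (?a ** Y n ** adj2 ?a) ** adj2 (u n))"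
      by (metis matrix_scaleR_left2 matrix_scaleR_right2)
    also have "u n ** (?a ** Y n ** adj2 ?a) ** adj2 (u n) = \<delta> n ** X ** adj2 (\<delta> n)"
      by (simp add: \<delta>_def Y_def adj2_matrix_mult matrix_mul_assoc)
    finally show ?thesis ..
  qed
  have dG: "\<delta> n \<in> \<Gamma>" for n using mem by (simp add: \<delta>_def)
  have "\<delta> n ** X ** adj2 (\<delta> n) \<in> tangent_cone \<Gamma>" for n
    using G dG[of n] by (intro tangent_cone_conjugate[OF X]) (auto simp: SL2_subgroup_def)
  then have T: "u n ** D n ** adj2 (u n) \<in> tangent_cone \<Gamma>" for n
    unfolding eq[symmetric] by (intro tangent_cone_scaleR) auto
  have "(\<lambda>n. u n ** D n ** adj2 (u n)) \<longlonglongrightarrow> mat 1 ** mat2 0 (X$1$2) 0 0 ** adj2 (mat 1)"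
    by (intro tendsto_intros ulim Dlim)
  then show ?thesis
    using closed_sequentially[OF closed_tangent_cone T] by simp
qed

text \<open>This is h \<Gamma> h^-1, written as a preimage so that closedness follows from
  continuity of conjugation.\<close>

definition conj_set :: "real^2^2 \<Rightarrow> (real^2^2) set \<Rightarrow> (real^2^2) set" where
  "conj_set h \<Gamma> = {A \<in> SL2. adj2 h ** A ** h \<in> \<Gamma>}"

lemma conj_set_subgroup:
  assumes "SL2_subgroup \<Gamma>" "h \<in> SL2"
  shows "SL2_subgroup (conj_set h \<Gamma>)"
  unfolding SL2_subgroup_def
proof (intro conjI ballI)
  show "conj_set h \<Gamma> \<subseteq> SL2" by (auto simp: conj_set_def)
  show "mat 1 \<in> conj_set h \<Gamma>" using assms by (simp add: conj_set_def SL2_subgroup_def)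
next
  fix A B assume AB: "A \<in> conj_set h \<Gamma>" "B \<in> conj_set h \<Gamma>"
  have "adj2 h ** (A ** B) ** h = (adj2 h ** A ** h) ** (adj2 h ** B ** h)"
    using assms(2) by (simp add: matrix_mul_assoc[symmetric])
  then show "A ** B \<in> conj_set h \<Gamma>" using AB assms(1) by (simp add: conj_set_def SL2_subgroup_def)
next
  fix A assume A: "A \<in> conj_set h \<Gamma>"
  have "adj2 h ** adj2 A ** h = adj2 (adj2 h ** A ** h)"
    by (simp add: adj2_matrix_mult matrix_mul_assoc)
  then show "adj2 A \<in> conj_set h \<Gamma>" using A assms(1) by (simp add: conj_set_def SL2_subgroup_def)
qed

lemma conj_set_closed:
  assumes "closed \<Gamma>"
  shows "closed (conj_set h \<Gamma>)"
proof -
  have "conj_set h \<Gamma> = SL2 \<inter> (\<lambda>A. adj2 h ** A ** h) -` \<Gamma>" by (auto simp: conj_set_def)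
  moreover have "closed \<dots>"
    by (intro closed_Int closed_SL2 closed_vimage assms continuous_intros)
  ultimately show ?thesis by simp
qed

lemma tangent_cone_conj_set:
  assumes "X \<in> tangent_cone \<Gamma>" "h \<in> SL2" "\<Gamma> \<subseteq> SL2"
  shows "h ** X ** adj2 h \<in> tangent_cone (conj_set h \<Gamma>)"
proof (rule tangent_cone_conjugate[OF assms(1,2)])
  fix \<gamma> assume "\<gamma> \<in> \<Gamma>"
  moreover have "adj2 h ** (h ** \<gamma> ** adj2 h) ** h = \<gamma>"
    using assms(2) by (simp add: matrix_mul_assoc[symmetric])
  ultimately show "h ** \<gamma> ** adj2 h \<in> conj_set h \<Gamma>" using assms by (auto simp: conj_set_def)
qed

lemma conj_set_conj_set:
  assumes "h \<in> SL2" "k \<in> SL2"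
  shows "conj_set h (conj_set k \<Gamma>) = conj_set (h ** k) \<Gamma>"
  using assms by (auto simp: conj_set_def adj2_matrix_mult matrix_mul_assoc)

text \<open>The two families are unipotent groups with different fixed lines, spanned by (1, 0) and
  (1, -1). A product upper, second, upper reaches every matrix with nonzero lower left entry; one
  more factor reaches the rest.\<close>

lemma SL2_subgroup_eqI:
  assumes G: "SL2_subgroup \<Gamma>"
    and u: "\<And>x. mat2 1 x 0 1 \<in> \<Gamma>"
    and w: "\<And>x. mat2 (1 + x) x (- x) (1 - x) \<in> \<Gamma>"
  shows "\<Gamma> = SL2"
proof
  show "\<Gamma> \<subseteq> SL2" using G by (simp add: SL2_subgroup_def)
  have mult: "A ** B \<in> \<Gamma>" if "A \<in> \<Gamma>" "B \<in> \<Gamma>" for A B using G that by (simp add: SL2_subgroup_def)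
  have nz: "A \<in> \<Gamma>" if A: "A \<in> SL2" "A$2$1 \<noteq> 0" for A
  proof -
    define c where "c = A$2$1"
    have c: "c \<noteq> 0" using A by (simp add: c_def)
    \<comment> \<open>The middle factor has lower left entry c. The left factor is solved for to
      correct entry (1,1), the right one to correct (2,2); the determinant then forces
      (1,2).\<close>
    define B where "B = mat2 1 ((A$1$1 - 1 + c) / c) 0 1 ** mat2 (1 + - c) (- c) (- (- c)) (1 - (- c)) ** mat2 1 ((A$2$2 - 1 - c) / c) 0 1"
    have e11: "B$1$1 = A$1$1" and e21: "B$2$1 = A$2$1" and e22: "B$2$2 = A$2$2"
      using c by (simp_all add: B_def c_def field_simps)
    have "B \<in> SL2" unfolding B_def by (intro SL2_mult) (auto simp: SL2_iff algebra_simps)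
    then have "B$1$2 * c = A$1$2 * c"
      using A(1) unfolding SL2_iff c_def e11 e21 e22 by linarith
    then have "B = A" using c e11 e21 e22 by (simp add: matrix2_eq_iff)
    moreover have "B \<in> \<Gamma>" unfolding B_def by (intro mult u w)
    ultimately show ?thesis by simp
  qed
  show "SL2 \<subseteq> \<Gamma>"
  proof
    fix A assume A: "A \<in> SL2"
    show "A \<in> \<Gamma>"
    proof (cases "A$2$1 = 0")
      case False then show ?thesis using nz A by simp
    next
      case True
      \<comment> \<open>Right multiplication by the inverse of \<open>?w\<close> turns the lower
        left entry 0 into \<open>- A$2$2\<close>, which is nonzero; \<open>?w\<close> itself is
        covered by \<open>nz\<close>.\<close>
      let ?w = "mat2 1 0 1 1"
      have w: "?w \<in> SL2" by (simp add: SL2_iff)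
      have "A$2$2 \<noteq> 0" using A True by (auto simp: SL2_iff)
      then have "A ** adj2 ?w \<in> \<Gamma>" using A w True by (intro nz) auto
      moreover have "?w \<in> \<Gamma>" using w by (intro nz) auto
      ultimately have "A ** adj2 ?w ** ?w \<in> \<Gamma>" by (rule mult)
      then show ?thesis using w by (simp add: matrix_mul_assoc[symmetric])
    qed
  qed
qed

text \<open>Conjugation by a lower unipotent matrix leaves the upper right entry of a direction unchanged,
  so the expansion argument applies to all these conjugates of the subgroup at once.\<close>

lemma SL2_subgroup_full_of_tangent:
  assumes G: "SL2_subgroup \<Gamma>" "closed \<Gamma>" and rec: "\<And>h. h \<in> SL2 \<Longrightarrow> recurrent_along_diagonal (conj_set h \<Gamma>)"
    and X: "X \<in> tangent_cone \<Gamma>" "X$1$2 \<noteq> 0"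
  shows "\<Gamma> = SL2"
proof -
  have key: "adj2 (mat2 1 0 s 1) ** mat2 1 x 0 1 ** mat2 1 0 s 1 \<in> \<Gamma>" for s x
  proof -
    let ?h = "mat2 1 0 s 1"
    let ?G = "conj_set ?h \<Gamma>"
    have h: "?h \<in> SL2" by (simp add: SL2_iff)
    have sg: "SL2_subgroup ?G" "closed ?G"
      using G h by (simp_all add: conj_set_subgroup conj_set_closed)
    have "?h ** X ** adj2 ?h \<in> tangent_cone ?G"
      using G X h by (intro tangent_cone_conj_set) (auto simp: SL2_subgroup_def)
    from tangent_cone_expand[OF sg(1) rec[OF h] this]
    have T: "mat2 0 (X$1$2) 0 0 \<in> tangent_cone ?G" by simp
    have pos: "mat2 1 (t * X$1$2) 0 1 \<in> ?G" if "t \<ge> 0" for t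
      using unipotent_mem_of_tangent[OF sg T that] .
    have "mat2 1 x 0 1 \<in> ?G"
    \<comment> \<open>A limit direction yields only half of the one-parameter group; inverses yield
      the other half.\<close>
    proof (cases "x / X$1$2 \<ge> 0")
      case True
      then show ?thesis using pos[OF True] X(2) by simp
    next
      case False
      then have "mat2 1 (- x) 0 1 \<in> ?G" using pos[of "- (x / X$1$2)"] X(2) by simp
      then have "adj2 (mat2 1 (- x) 0 1) \<in> ?G" using sg(1) by (simp add: SL2_subgroup_def)
      moreover have "adj2 (mat2 1 (- x) 0 1) = mat2 1 x 0 1" by (simp add: matrix2_eq_iff)
      ultimately show ?thesis by simp
    qed
    then show ?thesis by (simp add: conj_set_def)
  qed
  show ?thesis
  \<comment> \<open>The parameters s = 0 and s = 1 give the two unipotent groups.\<close>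
  proof (rule SL2_subgroup_eqI[OF G(1)])
    fix x
    have "adj2 (mat2 1 0 0 1) ** mat2 1 x 0 1 ** mat2 1 0 0 1 = mat2 1 x 0 1"
      by (simp add: matrix2_eq_iff)
    then show "mat2 1 x 0 1 \<in> \<Gamma>" using key[of 0 x] by simp
    have "adj2 (mat2 1 0 1 1) ** mat2 1 x 0 1 ** mat2 1 0 1 1 = mat2 (1 + x) x (- x) (1 - x)"
      by (simp add: matrix2_eq_iff)
    then show "mat2 (1 + x) x (- x) (1 - x) \<in> \<Gamma>" using key[of 1 x] by simp
  qed
qed

text \<open>Normalise \<gamma>_n - 1 and use compactness of the unit sphere. With Z = \<gamma> - 1
  the condition det \<gamma> = 1 reads tr Z = - det Z, which is quadratic in Z, so the rescaled
  trace vanishes in the limit.\<close>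

lemma nondiscrete_tangent:
  assumes G: "\<Gamma> \<subseteq> SL2" and nd: "\<And>\<epsilon>. \<epsilon> > 0 \<Longrightarrow> \<exists>\<gamma>\<in>\<Gamma>. \<gamma> \<noteq> mat 1 \<and> norm (\<gamma> - mat 1) < \<epsilon>"
  obtains X where "X \<in> tangent_cone \<Gamma>" "X \<noteq> 0" "X$1$1 + X$2$2 = 0"
proof -
  have "\<forall>n::nat. \<exists>\<gamma>. \<gamma> \<in> \<Gamma> \<and> \<gamma> \<noteq> mat 1 \<and> norm (\<gamma> - mat 1) < 1 / real (Suc n)"
    using nd by (metis zero_less_divide_1_iff of_nat_0_less_iff zero_less_Suc)
  then obtain \<gamma> where g: "\<And>n::nat. \<gamma> n \<in> \<Gamma>" "\<And>n. \<gamma> n \<noteq> mat 1" "\<And>n. norm (\<gamma> n - mat 1) < 1 / real (Suc n)"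
    by metis
  have lim: "(\<lambda>n. 1 / real (Suc n)) \<longlonglongrightarrow> 0"
    using LIMSEQ_inverse_real_of_nat by (simp add: inverse_eq_divide)
  have glim: "\<gamma> \<longlonglongrightarrow> mat 1"
    by (rule LIM_zero_cancel, rule Lim_null_comparison[OF _ lim])
      (rule always_eventually, simp add: g less_imp_le del: of_nat_Suc)
  define s where "s n = 1 / norm (\<gamma> n - mat 1)" for n
  have s: "s n > 0" for n using g(2)[of n] by (simp add: s_def)
  define Y where "Y n = s n *\<^sub>R (\<gamma> n - mat 1)" for n
  have "Y n \<in> sphere 0 1" for n using g(2)[of n] by (simp add: Y_def s_def)
  then obtain X r where X: "X \<in> sphere 0 1" and r: "strict_mono (r :: nat \<Rightarrow> nat)" and Xlim: "(Y \<circ> r) \<longlonglongrightarrow> X"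
    using compact_sphere[of "0::real^2^2" 1] unfolding compact_def by metis
  have g': "(\<gamma> \<circ> r) \<longlonglongrightarrow> mat 1" by (rule LIMSEQ_subseq_LIMSEQ[OF glim r])
  have Xl: "(\<lambda>n. s (r n) *\<^sub>R (\<gamma> (r n) - mat 1)) \<longlonglongrightarrow> X" using Xlim by (simp add: o_def Y_def)
  have "X \<in> tangent_cone \<Gamma>"
    unfolding tangent_cone_iff_sequentially using g' Xl g(1) s
    by (intro exI[of _ "\<gamma> \<circ> r"] exI[of _ "s \<circ> r"]) auto
  moreover have "X$1$1 + X$2$2 = 0"
  proof -
    define Z where "Z n = \<gamma> (r n) - mat 1" for n
    have Z0: "Z \<longlonglongrightarrow> 0" using g' unfolding Z_def by (simp add: LIM_zero_iff o_def)
    have Z1: "(\<lambda>n. s (r n) *\<^sub>R Z n) \<longlonglongrightarrow> X" using Xl by (simp add: Z_def)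
    have det: "Z n $ 1 $ 1 + Z n $ 2 $ 2 = Z n $ 1 $ 2 * Z n $ 2 $ 1 - Z n $ 1 $ 1 * Z n $ 2 $ 2" for n
    proof -
      have "\<gamma> (r n) \<in> SL2" using g G by auto
      then show ?thesis by (simp add: Z_def SL2_iff algebra_simps)
    qed
    have e: "s (r n) * Z n $ 1 $ 1 + s (r n) * Z n $ 2 $ 2 = (s (r n) * Z n $ 1 $ 2) * Z n $ 2 $ 1 - (s (r n) * Z n $ 1 $ 1) * Z n $ 2 $ 2" for n
      using arg_cong[OF det[of n], of "\<lambda>x. s (r n) * x"] by (simp add: algebra_simps)
    have c: "(\<lambda>n. s (r n) * Z n $ i $ j) \<longlonglongrightarrow> X $ i $ j" for i j
      using tendsto_vec_nth[OF tendsto_vec_nth[OF Z1, of i], of j] by simp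
    have c0: "(\<lambda>n. Z n $ i $ j) \<longlonglongrightarrow> 0" for i j
      using tendsto_vec_nth[OF tendsto_vec_nth[OF Z0, of i], of j] by simp
    have "(\<lambda>n. s (r n) * Z n $ 1 $ 1 + s (r n) * Z n $ 2 $ 2) \<longlonglongrightarrow> X$1$1 + X$2$2"
      by (intro tendsto_add c)
    moreover have "(\<lambda>n. s (r n) * Z n $ 1 $ 1 + s (r n) * Z n $ 2 $ 2) \<longlonglongrightarrow> X$1$2 * 0 - X$1$1 * 0"
      unfolding e by (intro tendsto_diff tendsto_mult c c0)
    ultimately show ?thesis using LIMSEQ_unique by fastforce
  qed
  moreover have "X \<noteq> 0" using X by auto
  ultimately show ?thesis using that by blast
qed

theorem SL2_subgroup_full_of_nondiscrete:
  assumes G: "SL2_subgroup \<Gamma>" "closed \<Gamma>" and rec: "\<And>h. h \<in> SL2 \<Longrightarrow> recurrent_along_diagonal (conj_set h \<Gamma>)"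
    and nd: "\<And>\<epsilon>. \<epsilon> > 0 \<Longrightarrow> \<exists>\<gamma>\<in>\<Gamma>. \<gamma> \<noteq> mat 1 \<and> norm (\<gamma> - mat 1) < \<epsilon>"
  shows "\<Gamma> = SL2"
proof -
  have sub: "\<Gamma> \<subseteq> SL2" using G by (simp add: SL2_subgroup_def)
  obtain X where X: "X \<in> tangent_cone \<Gamma>" "X \<noteq> 0" and tr: "X$1$1 + X$2$2 = 0"
    using nondiscrete_tangent[OF sub nd] by blast
  \<comment> \<open>A conjugation that makes the upper right entry nonzero: the quarter turn puts
    \<open>- X$2$1\<close> there, and for X = diag(a, -a) the shear creates -2a. Trace zero excludes
    scalar X.\<close>
  obtain h where h: "h \<in> SL2" "(h ** X ** adj2 h)$1$2 \<noteq> 0"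
  proof (cases "X$1$2 = 0")
    case False
    then show ?thesis using that[of "mat 1"] by simp
  next
    case q: True
    show ?thesis
    proof (cases "X$2$1 = 0")
      case False
      then show ?thesis using that[of "mat2 0 1 (-1) 0"] by (simp add: SL2_iff)
    next
      case True
      have "X$1$1 \<noteq> 0" using X(2) q True tr by (auto simp: matrix2_eq_iff)
      then show ?thesis using that[of "mat2 1 1 0 1"] q True tr by (simp add: SL2_iff)
    qed
  qed
  have "conj_set h \<Gamma> = SL2"
  proof (rule SL2_subgroup_full_of_tangent)
    show "SL2_subgroup (conj_set h \<Gamma>)" "closed (conj_set h \<Gamma>)"
      using G h by (simp_all add: conj_set_subgroup conj_set_closed)
    show "recurrent_along_diagonal (conj_set k (conj_set h \<Gamma>))" if "k \<in> SL2" for k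
      using that h rec by (simp add: conj_set_conj_set)
    show "h ** X ** adj2 h \<in> tangent_cone (conj_set h \<Gamma>)"
      using X h sub by (intro tangent_cone_conj_set)
    show "(h ** X ** adj2 h)$1$2 \<noteq> 0" by (rule h)
  qed
  then have "A \<in> \<Gamma>" if "A \<in> SL2" for A
  proof -
    have "h ** A ** adj2 h \<in> conj_set h \<Gamma>" using \<open>conj_set h \<Gamma> = SL2\<close> h that by simp
    then have "adj2 h ** (h ** A ** adj2 h) ** h \<in> \<Gamma>" by (simp add: conj_set_def)
    then show ?thesis using h by (simp add: matrix_mul_assoc[symmetric])
  qed
  then show ?thesis using sub by blast
qed

subsection \<open>The group and its actions\<close>

lemma Rep_psl2_of: "A \<in> SL2 \<Longrightarrow> Rep_psl2 (psl2_of A) = {A, - A}"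
  unfolding psl2_of_def by (rule Abs_psl2_inverse) (auto simp: SL2_def)

lemma psl2_of_minus [simp]: "psl2_of (- A) = psl2_of A"
  by (simp add: psl2_of_def insert_commute)

lemma psl2_of_eq_iff:
  assumes "A \<in> SL2" "B \<in> SL2"
  shows "psl2_of A = psl2_of B \<longleftrightarrow> A = B \<or> A = - B"
proof
  assume "psl2_of A = psl2_of B"
  then have "{A, - A} = {B, - B}" using Rep_psl2_of assms by metis
  then show "A = B \<or> A = - B" by auto
qed auto

lemma psl2_cases:
  obtains A where "A \<in> SL2" "x = psl2_of A"
proof (cases x)
  case (Abs_psl2 y)
  then obtain A where "y = {A, - A}" "det A = 1" by auto
  then show ?thesis using that[of A] Abs_psl2 by (simp add: psl2_of_def SL2_def)
qed

lemma psl2_rep: "psl2_rep x \<in> SL2" "psl2_of (psl2_rep x) = x"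
proof -
  obtain A where A: "A \<in> SL2" "x = psl2_of A" by (rule psl2_cases)
  then have "psl2_rep x \<in> {A, - A}"
    unfolding psl2_rep_def using Rep_psl2_of[OF A(1)] by (metis insertI1 someI_ex)
  then show "psl2_rep x \<in> SL2" "psl2_of (psl2_rep x) = x" using A by auto
qed

lemma minus_matrix_mult [simp]: "(- A) ** B = - (A ** B)" "A ** (- B) = - (A ** B)" for A B :: "real^2^2"
  by (simp_all add: matrix2_eq_iff)

lemma adj2_minus [simp]: "adj2 (- A) = - adj2 A"
  by (simp add: matrix2_eq_iff)

lemma psl2_of_mult [simp]:
  assumes "A \<in> SL2" "B \<in> SL2"
  shows "psl2_of A * psl2_of B = psl2_of (A ** B)"
proof -
  have "psl2_rep (psl2_of A) = A \<or> psl2_rep (psl2_of A) = - A" "psl2_rep (psl2_of B) = B \<or> psl2_rep (psl2_of B) = - B"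
    using psl2_of_eq_iff psl2_rep assms by metis+
  then show ?thesis unfolding times_psl2_def by auto
qed

lemma psl2_inv_of [simp]:
  assumes "A \<in> SL2"
  shows "psl2_inv (psl2_of A) = psl2_of (adj2 A)"
proof -
  have "psl2_rep (psl2_of A) = A \<or> psl2_rep (psl2_of A) = - A"
    using psl2_of_eq_iff psl2_rep assms by metis
  then show ?thesis unfolding psl2_inv_def by (auto simp: matrix_inv_SL2 assms)
qed

lemma psl2_mult_assoc: "(x * y) * z = x * (y * z)" for x y z :: psl2
  by (cases x rule: psl2_cases; cases y rule: psl2_cases; cases z rule: psl2_cases)
    (simp add: matrix_mul_assoc)

lemma psl2_one_mult [simp]: "1 * x = x" "x * 1 = x" for x :: psl2
  by (cases x rule: psl2_cases; simp add: one_psl2_def)+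

lemma psl2_inv_mult [simp]: "psl2_inv x * x = 1" "x * psl2_inv x = 1"
  by (cases x rule: psl2_cases; simp add: one_psl2_def)+

lemma psl2_inv_inv [simp]: "psl2_inv (psl2_inv x) = x"
  by (cases x rule: psl2_cases) simp

lemma psl2_inv_times: "psl2_inv (x * y) = psl2_inv y * psl2_inv x"
  by (cases x rule: psl2_cases; cases y rule: psl2_cases) (simp add: adj2_matrix_mult)

lemma continuous_on_psl2_of: "continuous_on SL2 psl2_of"
  unfolding continuous_on_open_invariant
proof (intro allI impI)
  fix B :: "psl2 set" assume "open B"
  then obtain T where "open T" "{A \<in> SL2. psl2_of A \<in> B} = SL2 \<inter> T"
    by (auto simp: open_psl2_def openin_open)
  then show "\<exists>A. open A \<and> A \<inter> SL2 = psl2_of -` B \<inter> SL2"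
    by (intro exI[of _ T]) auto
qed

text \<open>The topology is the quotient by negation, and the saturation of \<open>T\<close> is the
  union of \<open>T\<close> and its negative, which is open.\<close>

lemma open_psl2_of_image:
  assumes "open T"
  shows "open (psl2_of ` (SL2 \<inter> T))"
proof -
  have "{A \<in> SL2. psl2_of A \<in> psl2_of ` (SL2 \<inter> T)} = SL2 \<inter> (T \<union> uminus -` T)"
    by (auto simp: psl2_of_eq_iff) (metis psl2_of_eq_iff IntI SL2_minus image_eqI psl2_of_minus)+
  moreover have "open (T \<union> uminus -` T)"
    by (intro open_Un assms open_vimage continuous_intros)
  ultimately show ?thesis unfolding open_psl2_def by (metis openin_open_Int)
qed

lemma compact_SL2_cball: "compact (SL2 \<inter> cball A r)"
  by (rule closed_Int_compact[OF closed_SL2 compact_cball])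

lemma compact_psl2_ball: "compact (psl2_of ` (SL2 \<inter> cball A r))"
  by (intro compact_continuous_image continuous_on_subset[OF continuous_on_psl2_of] compact_SL2_cball) auto

text \<open>The centre 0 makes the ball stable under negation, so that it is the whole preimage of
  its image.\<close>

lemma closed_psl2_ball: "closed (psl2_of ` (SL2 \<inter> cball 0 r))"
proof -
  have "{A \<in> SL2. psl2_of A \<in> - psl2_of ` (SL2 \<inter> cball 0 r)} = SL2 \<inter> - cball 0 r"
    by (auto simp: psl2_of_eq_iff)
  then show ?thesis unfolding closed_def open_psl2_def
    by (metis openin_open_Int open_Compl closed_cball)
qed

section \<open>Haar measure and product measurability\<close>

lemma haar_sigma_finite:
  assumes "haar_measure H"
  shows "sigma_finite_measure H"
proof
  have sets: "sets H = sets borel" and cpt: "\<And>K. compact K \<Longrightarrow> emeasure H K < \<infinity>"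
    using assms by (auto simp: haar_measure_def)
  have sp: "space H = UNIV" using sets_eq_imp_space_eq[OF sets] by simp
  let ?K = "\<lambda>n::nat. psl2_of ` (SL2 \<inter> cball 0 (real n))"
  show "\<exists>A. countable A \<and> A \<subseteq> sets H \<and> \<Union> A = space H \<and> (\<forall>a\<in>A. emeasure H a \<noteq> \<infinity>)"
  proof (intro exI[of _ "range ?K"] conjI ballI)
    show "range ?K \<subseteq> sets H" using closed_psl2_ball by (auto simp: sets)
    show "\<Union> (range ?K) = space H" unfolding sp
    proof (intro equalityI subsetI UNIV_I)
      fix x :: psl2
      obtain A where A: "A \<in> SL2" "x = psl2_of A" by (rule psl2_cases)
      obtain n :: nat where "norm A \<le> n" using real_arch_simple by blast
      then have "x \<in> ?K n" using A by auto
      then show "x \<in> \<Union> (range ?K)" by blast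
    qed
    show "emeasure H a \<noteq> \<infinity>" if "a \<in> range ?K" for a
      using that cpt[OF compact_psl2_ball] by (auto simp: less_top[symmetric])
  qed auto
qed

text \<open>If \<open>W\<close> were null, so would be all its left translates, and countably many
  of them cover the group. Lindelof is applied upstairs, in the second countable space of
  matrices.\<close>

lemma haar_open_pos:
  assumes H: "haar_measure H" and W: "open W" "W \<noteq> {}"
  shows "emeasure H W > 0"
proof (rule ccontr)
  assume "\<not> emeasure H W > 0"
  then have W0: "emeasure H W = 0" by simp
  have sets: "sets H = sets borel" and inv: "\<And>g A. A \<in> sets borel \<Longrightarrow> emeasure H ((\<lambda>h. g * h) ` A) = emeasure H A"
    using H by (auto simp: haar_measure_def)
  define V where "V = {A \<in> SL2. psl2_of A \<in> W}"
  have V: "openin (top_of_set SL2) V" using W by (simp add: V_def open_psl2_def)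
  \<comment> \<open>The preimage in \<open>SL2\<close> of the translate of \<open>W\<close> by
    \<open>psl2_of B\<close>.\<close>
  define tr where "tr B = {C \<in> SL2. adj2 B ** C \<in> V}" for B
  have tr: "openin (top_of_set SL2) (tr B)" if "B \<in> SL2" for B
  proof -
    have "openin (top_of_set SL2) (SL2 \<inter> (\<lambda>C. adj2 B ** C) -` V)"
      using that by (intro continuous_openin_preimage[OF _ _ V] continuous_intros) auto
    moreover have "SL2 \<inter> (\<lambda>C. adj2 B ** C) -` V = tr B" by (auto simp: tr_def)
    ultimately show ?thesis by simp
  qed
  have tri: "(\<lambda>h. psl2_of B * h) ` W = psl2_of ` tr B" and trj: "{A \<in> SL2. psl2_of A \<in> psl2_of ` tr B} = tr B"
    if B: "B \<in> SL2" for B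
  proof -
    have neg: "- C \<in> V" if "C \<in> V" for C using that by (simp add: V_def)
    show "(\<lambda>h. psl2_of B * h) ` W = psl2_of ` tr B"
    proof (intro equalityI subsetI)
      fix y assume "y \<in> (\<lambda>h. psl2_of B * h) ` W"
      then obtain h where h: "h \<in> W" "y = psl2_of B * h" by auto
      obtain C where C: "C \<in> SL2" "h = psl2_of C" by (rule psl2_cases)
      then have "B ** C \<in> tr B" using h B by (simp add: tr_def V_def)
      then show "y \<in> psl2_of ` tr B" using h C B by auto
    next
      fix y assume "y \<in> psl2_of ` tr B"
      then obtain C where C: "C \<in> SL2" "adj2 B ** C \<in> V" "y = psl2_of C" by (auto simp: tr_def)
      then have "y = psl2_of B * psl2_of (adj2 B ** C)" using B by simp
      then show "y \<in> (\<lambda>h. psl2_of B * h) ` W" using C by (auto simp: V_def)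
    qed
    show "{A \<in> SL2. psl2_of A \<in> psl2_of ` tr B} = tr B"
      using neg by (fastforce simp: tr_def psl2_of_eq_iff)
  qed
  obtain F where F: "F \<subseteq> tr ` SL2" "countable F" "\<Union>F = \<Union>(tr ` SL2)"
    using Lindelof_openin[of "tr ` SL2" SL2] tr by (metis imageE)
  then obtain S where S: "countable S" "S \<subseteq> SL2" "F = tr ` S"
    by (metis countable_subset_image)
  have "psl2_of ` tr B \<in> null_sets H" if "B \<in> S" for B
  proof
    have B: "B \<in> SL2" using that S by auto
    have "open (psl2_of ` tr B)" unfolding open_psl2_def trj[OF B] by (rule tr[OF B])
    then show "psl2_of ` tr B \<in> sets H" by (simp add: sets)
    show "emeasure H (psl2_of ` tr B) = 0"
      using inv[of W "psl2_of B"] W W0 tri[OF B] by simp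
  qed
  then have null: "(\<Union>B\<in>S. psl2_of ` tr B) \<in> null_sets H"
    using S by (intro null_sets_UN') auto
  have "(\<Union>B\<in>S. psl2_of ` tr B) = UNIV"
  proof (intro equalityI subset_UNIV subsetI)
    fix x :: psl2
    obtain A where A: "A \<in> SL2" "x = psl2_of A" by (rule psl2_cases)
    obtain w where "w \<in> W" using W by auto
    obtain C where C: "C \<in> SL2" "w = psl2_of C" by (rule psl2_cases)
    have "adj2 (A ** adj2 C) ** A = C"
      using A C by (simp add: adj2_matrix_mult matrix_mul_assoc[symmetric])
    then have "A \<in> tr (A ** adj2 C)" using A C \<open>w \<in> W\<close> by (simp add: tr_def V_def)
    then have "A \<in> \<Union>(tr ` SL2)" using A C by (intro UN_I[of "A ** adj2 C"]) auto
    then have "A \<in> \<Union>(tr ` S)" using F S by simp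
    then show "x \<in> (\<Union>B\<in>S. psl2_of ` tr B)" using A by auto
  qed
  then have "emeasure H UNIV = 0" using null by auto
  then show False using H by (simp add: haar_measure_def)
qed

text \<open>The space need not be second countable; that the group is suffices for Tonelli's theorem below.\<close>

lemma open_in_product_sigma_algebra:
  fixes S :: "(psl2 \<times> 'x::topological_space) set"
  assumes S: "open S"
  shows "S \<in> sets (borel \<Otimes>\<^sub>M borel)"
proof -
  obtain \<B> :: "(real^2^2) set set" where B: "countable \<B>" "topological_basis \<B>"
    using ex_countable_basis by blast
  define U where "U b = psl2_of ` (SL2 \<inter> b)" for b
  \<comment> \<open>The largest open set whose product with \<open>U b\<close> lies in
    \<open>S\<close>; one such set for each basic \<open>b\<close> leaves a countable union.\<close>
  define V where "V b = \<Union>{T. open T \<and> U b \<times> T \<subseteq> S}" for b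
  have "S = (\<Union>b\<in>\<B>. U b \<times> V b)"
  proof (intro equalityI subsetI)
    fix z assume z: "z \<in> S"
    obtain g x where gx: "z = (g, x)" by fastforce
    obtain P T where P: "open P" "open T" "g \<in> P" "x \<in> T" "P \<times> T \<subseteq> S"
      using S z gx unfolding open_prod_def by fastforce
    obtain A where A: "A \<in> SL2" "g = psl2_of A" by (rule psl2_cases)
    obtain Q where Q: "open Q" "{A \<in> SL2. psl2_of A \<in> P} = SL2 \<inter> Q"
      using P(1) by (auto simp: open_psl2_def openin_open)
    have "A \<in> Q" using A P Q by auto
    then obtain b where b: "b \<in> \<B>" "A \<in> b" "b \<subseteq> Q"
      using topological_basisE[OF B(2) Q(1)] by metis
    have "U b \<subseteq> P" using b Q by (auto simp: U_def)
    then have "U b \<times> T \<subseteq> S" using P by blast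
    then have "x \<in> V b" using P by (auto simp: V_def)
    moreover have "g \<in> U b" using A b by (auto simp: U_def)
    ultimately show "z \<in> (\<Union>b\<in>\<B>. U b \<times> V b)" using b gx by auto
  next
    fix z assume "z \<in> (\<Union>b\<in>\<B>. U b \<times> V b)"
    then show "z \<in> S" by (auto simp: V_def)
  qed
  moreover have "U b \<times> V b \<in> sets (borel \<Otimes>\<^sub>M borel)" if "b \<in> \<B>" for b
  proof -
    have "open b" using B that by (simp add: topological_basis_open)
    then have "open (U b)" unfolding U_def by (rule open_psl2_of_image)
    moreover have "open (V b)" unfolding V_def by auto
    ultimately show ?thesis by (intro pair_measureI) auto
  qed
  ultimately show ?thesis using B by auto
qed

locale psl2_space =
  fixes act :: "psl2 \<Rightarrow> 'x::t2_space \<Rightarrow> 'x"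
  assumes G_space: "G_space act"
begin

text \<open>Pulls the action back to matrices. Off \<open>SL2\<close> the value of
  \<open>psl2_of\<close> is unspecified, whence the membership premises below.\<close>

definition mact :: "real^2^2 \<Rightarrow> 'x \<Rightarrow> 'x" where
  "mact A x = act (psl2_of A) x"

definition translates :: "(real^2^2) set \<Rightarrow> 'x set \<Rightarrow> 'x set" where
  "translates S B = (\<Union>A\<in>S. mact A ` B)"

lemma act_mult: "act (g * h) x = act g (act h x)" and act_one [simp]: "act 1 x = x"
  and continuous_act: "continuous_on UNIV (\<lambda>(g, x). act g x)"
  using G_space by (auto simp: G_space_def)

lemma mact_one [simp]: "mact (mat 1) x = x"
  using act_one by (simp add: mact_def one_psl2_def)

lemma mact_mult: "A \<in> SL2 \<Longrightarrow> B \<in> SL2 \<Longrightarrow> mact (A ** B) x = mact A (mact B x)"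
  by (simp add: mact_def act_mult[symmetric])

lemma mact_adj2 [simp]: "A \<in> SL2 \<Longrightarrow> mact (adj2 A) (mact A x) = x" "A \<in> SL2 \<Longrightarrow> mact A (mact (adj2 A) x) = x"
  by (simp_all add: mact_mult[symmetric])

lemma mact_eq_iff: "A \<in> SL2 \<Longrightarrow> mact A x = y \<longleftrightarrow> x = mact (adj2 A) y"
  by auto

lemma continuous_on_mact:
  assumes "continuous_on S f" "continuous_on S g" "f ` S \<subseteq> SL2"
  shows "continuous_on S (\<lambda>z. mact (f z) (g z))"
proof -
  have "continuous_on S (\<lambda>z. psl2_of (f z))"
    using continuous_on_compose2[OF continuous_on_psl2_of assms(1)] assms(3) by auto
  then have "continuous_on S (\<lambda>z. (psl2_of (f z), g z))"
    by (intro continuous_on_Pair assms)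
  from continuous_on_compose2[OF continuous_act this] show ?thesis by (simp add: mact_def)
qed

lemma continuous_on_mact_point: "A \<in> SL2 \<Longrightarrow> continuous_on S (mact A)"
  using continuous_on_mact[OF continuous_on_const[of S A] continuous_on_id] by auto

lemma continuous_on_mact_orbit: "S \<subseteq> SL2 \<Longrightarrow> continuous_on S (\<lambda>A. mact A x)"
  using continuous_on_mact[OF continuous_on_id continuous_on_const[of S x]] by auto

lemma mact_image: "A \<in> SL2 \<Longrightarrow> mact A ` U = mact (adj2 A) -` U"
  by (auto simp: image_iff) (metis mact_adj2(2))

lemma open_mact_image:
  assumes "A \<in> SL2" "open U"
  shows "open (mact A ` U)"
  unfolding mact_image[OF assms(1)]
  using assms by (intro open_vimage continuous_on_mact_point) auto

lemma closed_mact_image: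
  assumes "A \<in> SL2" "closed U"
  shows "closed (mact A ` U)"
  unfolding mact_image[OF assms(1)]
  using assms by (intro closed_vimage continuous_on_mact_point) auto

lemma open_translates: "S \<subseteq> SL2 \<Longrightarrow> open B \<Longrightarrow> open (translates S B)"
  unfolding translates_def by (intro open_UN ballI open_mact_image) auto

lemma compact_orbit:
  assumes "compact K" "K \<subseteq> SL2"
  shows "compact ((\<lambda>A. mact A x) ` K)"
  using assms by (intro compact_continuous_image continuous_on_mact_orbit)

end

subsection \<open>The measure of thickened open sets\<close>

lemma continuous_on_psl2I:
  fixes f :: "psl2 \<Rightarrow> 'b::topological_space"
  assumes "continuous_on SL2 (\<lambda>A. f (psl2_of A))"
  shows "continuous_on UNIV f"
  unfolding continuous_on_open_vimage[OF open_UNIV]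
proof (intro allI impI)
  fix B :: "'b set" assume "open B"
  then have "openin (top_of_set SL2) (SL2 \<inter> (\<lambda>A. f (psl2_of A)) -` B)"
    using assms continuous_openin_preimage_gen by blast
  moreover have "SL2 \<inter> (\<lambda>A. f (psl2_of A)) -` B = {A \<in> SL2. psl2_of A \<in> f -` B}" by auto
  ultimately show "open (f -` B \<inter> UNIV)" by (simp add: open_psl2_def)
qed

lemma continuous_on_psl2_inv: "continuous_on UNIV psl2_inv"
proof (rule continuous_on_psl2I)
  have "continuous_on SL2 (\<lambda>A. psl2_of (adj2 A))"
    by (rule continuous_on_compose2[OF continuous_on_psl2_of]) (auto intro!: continuous_intros)
  then show "continuous_on SL2 (\<lambda>A. psl2_inv (psl2_of A))"
    by (rule continuous_on_eq) simp
qed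

lemma compact_cover_translates:
  assumes K: "compact K" "K \<subseteq> SL2" and e: "\<epsilon> > 0"
  obtains F where "finite F" "F \<subseteq> SL2" "\<And>A. A \<in> K \<Longrightarrow> \<exists>h\<in>F. adj2 h ** A \<in> SL2 \<inter> ball (mat 1) \<epsilon>"
proof -
  define U where "U h = (\<lambda>A. adj2 h ** A) -` ball (mat 1 :: real^2^2) \<epsilon>" for h
  have "open (U h)" for h unfolding U_def by (intro open_vimage continuous_intros) auto
  moreover have "K \<subseteq> (\<Union>h\<in>SL2. U h)"
  proof
    fix A assume "A \<in> K"
    then have "A \<in> SL2" using K by auto
    then show "A \<in> (\<Union>h\<in>SL2. U h)" using e by (intro UN_I[of A]) (auto simp: U_def)
  qed
  ultimately obtain F where F: "F \<subseteq> SL2" "finite F" "K \<subseteq> (\<Union>h\<in>F. U h)"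
    using compactE_image[OF K(1), of SL2 U] by metis
  show ?thesis
  proof (rule that[OF F(2,1)])
    fix A assume A: "A \<in> K"
    then obtain h where "h \<in> F" "A \<in> U h" using F by auto
    then show "\<exists>h\<in>F. adj2 h ** A \<in> SL2 \<inter> ball (mat 1) \<epsilon>"
      using F K A by (intro bexI[of _ h]) (auto simp: U_def subset_iff)
  qed
qed

text \<open>Here b is the measure of a thickened set and (1/2)^n / b the height put on it. With a =
  (1/2)^n and r > 1, a^r b^(1-r) blows up as b tends to 0. The first bound serves q = \<infinity>,
  the second finite q.\<close>

lemma small_measure_blowup:
  fixes r :: real and n :: nat
  assumes "r > 1"
  obtains \<eta> where "\<eta> > 0" "\<And>b. 0 < b \<Longrightarrow> b < \<eta> \<Longrightarrow> 2 ^ n \<le> (1/2) ^ n / b"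
    "\<And>b. 0 < b \<Longrightarrow> b < \<eta> \<Longrightarrow> 2 ^ n \<le> ((1/2) ^ n / b) powr r * b"
proof -
  define a :: real where "a = (1/2) ^ n"
  have a: "a > 0" by (simp add: a_def)
  \<comment> \<open>The first term makes the height at least 2^n; the second solves b^(r-1) = a^r a,
    that is a^r b^(1-r) = 1/a = 2^n.\<close>
  define \<eta> where "\<eta> = min ((1/4) ^ n) ((a powr r * a) powr (1 / (r - 1)))"
  show ?thesis
  proof (rule that[of \<eta>])
    show "\<eta> > 0" using a by (simp add: \<eta>_def)
  next
    fix b :: real assume b: "0 < b" "b < \<eta>"
    have "2 ^ n * b \<le> 2 ^ n * (1/4) ^ n" using b by (simp add: \<eta>_def)
    also have "\<dots> = (1/2) ^ n" by (simp add: power_mult_distrib[symmetric])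
    finally show "2 ^ n \<le> (1/2) ^ n / b" using b by (simp add: pos_le_divide_eq)
  next
    fix b :: real assume b: "0 < b" "b < \<eta>"
    have "b powr (r - 1) \<le> ((a powr r * a) powr (1 / (r - 1))) powr (r - 1)"
      using b assms by (intro powr_mono2) (auto simp: \<eta>_def)
    also have "\<dots> = a powr r * a" using assms a by (simp add: powr_powr)
    finally have le: "b powr (r - 1) \<le> a powr r * a" .
    have "2 ^ n = 1 / a" by (simp add: a_def power_one_over)
    also have "\<dots> \<le> a powr r / b powr (r - 1)"
      using le a b by (simp add: field_simps)
    also have "\<dots> = (a / b) powr r * b"
      using a b by (simp add: powr_divide powr_diff)
    finally show "2 ^ n \<le> ((1/2) ^ n / b) powr r * b" by (simp add: a_def)
  qed
qed

text \<open>Lets the integral of \<phi>(1 + F) dominate that of \<phi> F^(1/P), in place of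
  Hoelder's inequality.\<close>

lemma powr_le_one_plus:
  fixes y :: real
  assumes "y \<ge> 0" "P \<ge> 1"
  shows "y powr (1 / P) \<le> 1 + y"
proof (cases "y \<le> 1")
  case True
  then have "y powr (1 / P) \<le> 1 powr (1 / P)" using assms by (intro powr_mono2) auto
  then show ?thesis using assms by simp
next
  case False
  then have "y powr (1 / P) \<le> y powr 1" using assms by (intro powr_mono) auto
  then show ?thesis using assms False by simp
qed

section \<open>Convolution estimates and the lower bound\<close>

locale psl2_prob_space = psl2_space act for act :: "psl2 \<Rightarrow> 'x::t2_space \<Rightarrow> 'x" +
  fixes \<mu> :: "'x measure"
  assumes prob_mu: "prob_space \<mu>"
    and sets_mu: "sets \<mu> = sets borel"
    and invariant: "\<And>g A. A \<in> sets borel \<Longrightarrow> emeasure \<mu> (act g ` A) = emeasure \<mu> A"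
    and full_support: "\<And>U. open U \<Longrightarrow> U \<noteq> {} \<Longrightarrow> emeasure \<mu> U > 0"
begin

lemma space_mu: "space \<mu> = UNIV"
  using sets_eq_imp_space_eq[OF sets_mu] by simp

lemma act_image: "act g ` U = {x. act (psl2_inv g) x \<in> U}"
proof (intro equalityI subsetI)
  fix y assume "y \<in> act g ` U"
  then show "y \<in> {x. act (psl2_inv g) x \<in> U}" by (auto simp: act_mult[symmetric])
next
  fix y assume y: "y \<in> {x. act (psl2_inv g) x \<in> U}"
  have "y = act g (act (psl2_inv g) y)" by (simp add: act_mult[symmetric])
  then show "y \<in> act g ` U" using y by blast
qed

lemma emeasure_mact_image: "U \<in> sets borel \<Longrightarrow> emeasure \<mu> (mact A ` U) = emeasure \<mu> U"
  using invariant[of U "psl2_of A"] by (simp add: mact_def[abs_def])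

lemma continuous_act_inv: "continuous_on UNIV (\<lambda>(g, x). act (psl2_inv g) x)"
proof -
  have "continuous_on UNIV (\<lambda>z::psl2 \<times> 'x. (psl2_inv (fst z), snd z))"
    by (intro continuous_on_Pair continuous_on_compose2[OF continuous_on_psl2_inv] continuous_intros) auto
  from continuous_on_compose2[OF continuous_act this] show ?thesis
    by (simp add: case_prod_beta')
qed

text \<open>\<open>N\<close> is fixed before \<open>B\<close>: it counts translates of the
  \<epsilon>-ball that cover the compact set of products A^-1 D, which depends on \<open>C\<close>
  and \<epsilon> only. By invariance each translate has the same measure.\<close>

lemma emeasure_translates_le:
  assumes e: "\<epsilon> > 0" and C: "C \<in> SL2"
  obtains N :: nat where "\<And>B. open B \<Longrightarrow>
     emeasure \<mu> (translates (adj2 ` (SL2 \<inter> ball C 1)) (translates (SL2 \<inter> ball (mat 1) \<epsilon>) B))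
       \<le> of_nat N * emeasure \<mu> (translates (SL2 \<inter> ball (mat 1) \<epsilon>) B)"
proof -
  define K where "K = (\<lambda>(A, D). adj2 A ** D) ` ((SL2 \<inter> cball C 1) \<times> (SL2 \<inter> cball (mat 1) \<epsilon>))"
  have "compact K" unfolding K_def
    by (intro compact_continuous_image compact_Times compact_SL2_cball)
      (auto intro!: continuous_intros simp: case_prod_beta')
  moreover have "K \<subseteq> SL2" by (auto simp: K_def)
  ultimately obtain F where F: "finite F" "F \<subseteq> SL2" "\<And>A. A \<in> K \<Longrightarrow> \<exists>h\<in>F. adj2 h ** A \<in> SL2 \<inter> ball (mat 1) \<epsilon>"
    using compact_cover_translates[OF _ _ e] by metis
  show ?thesis
  proof (rule that[of "card F"])
    fix B :: "'x set" assume B: "open B"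
    let ?O = "SL2 \<inter> ball (mat 1 :: real^2^2) \<epsilon>"
    let ?B = "translates ?O B"
    have oB: "open ?B" using B by (intro open_translates) auto
    have "translates (adj2 ` (SL2 \<inter> ball C 1)) ?B \<subseteq> (\<Union>h\<in>F. mact h ` ?B)"
    proof
      fix z assume "z \<in> translates (adj2 ` (SL2 \<inter> ball C 1)) ?B"
      then obtain A D b where z: "A \<in> SL2" "A \<in> ball C 1" "D \<in> ?O" "b \<in> B" "z = mact (adj2 A) (mact D b)"
        by (auto simp: translates_def)
      have "adj2 A ** D \<in> K" unfolding K_def using z by (intro image_eqI[of _ _ "(A, D)"]) auto
      then obtain h where h: "h \<in> F" "adj2 h ** (adj2 A ** D) \<in> ?O" using F by blast
      then have hS: "h \<in> SL2" using F by auto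
      have "z = mact (h ** (adj2 h ** (adj2 A ** D))) b" using z hS by (simp add: mact_mult)
      also have "\<dots> = mact h (mact (adj2 h ** (adj2 A ** D)) b)" using h hS by (intro mact_mult) auto
      finally show "z \<in> (\<Union>h\<in>F. mact h ` ?B)" using h z unfolding translates_def by blast
    qed
    then have "emeasure \<mu> (translates (adj2 ` (SL2 \<inter> ball C 1)) ?B) \<le> emeasure \<mu> (\<Union>h\<in>F. mact h ` ?B)"
      using F oB by (intro emeasure_mono sets.finite_UN) (auto simp: sets_mu intro!: borel_open open_mact_image)
    also have "\<dots> \<le> (\<Sum>h\<in>F. emeasure \<mu> (mact h ` ?B))"
      using F oB by (intro emeasure_subadditive_finite) (auto simp: sets_mu intro!: borel_open open_mact_image)
    also have "\<dots> = of_nat (card F) * emeasure \<mu> ?B"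
      using oB by (simp add: emeasure_mact_image)
    finally show "emeasure \<mu> (translates (adj2 ` (SL2 \<inter> ball C 1)) ?B) \<le> of_nat (card F) * emeasure \<mu> ?B" .
  qed
qed

text \<open>The premise \<open>fin\<close> does two things: it makes the integrand integrable, and
  it excludes, up to a null set, infinite values of \<open>F\<close> where \<phi> > 0, which
  \<open>enn2real\<close> would send to 0.\<close>

lemma G_conv_lower_bound:
  fixes F :: "'x \<Rightarrow> ennreal" and P d :: real
  assumes H: "haar_measure H" and phi: "integrable H \<phi>" "\<And>g. 0 \<le> \<phi> g"
    and F: "F \<in> borel_measurable borel" and P: "P \<ge> 1" and d: "d \<ge> 0"
    and fin: "(\<integral>\<^sup>+ g. ennreal (\<phi> g) * (1 + F (act (psl2_inv g) x)) \<partial>H) \<noteq> \<infinity>"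
    and W: "W \<in> sets H" and big: "\<And>g. g \<in> W \<Longrightarrow> ennreal d \<le> F (act (psl2_inv g) x)"
  shows "d powr (1 / P) * (\<integral>g. \<phi> g * indicator W g \<partial>H) \<le> G_conv H act \<phi> (\<lambda>y. enn2real (F y) powr (1 / P)) x"
proof -
  have sH: "sets H = sets borel" using H by (simp add: haar_measure_def)
  have cont: "continuous_on UNIV (\<lambda>g. act (psl2_inv g) x)"
    using continuous_on_compose2[OF continuous_act_inv continuous_on_Pair[OF continuous_on_id continuous_on_const[of UNIV x]]]
    by simp
  have "(\<lambda>g. act (psl2_inv g) x) \<in> H \<rightarrow>\<^sub>M borel"
    using borel_measurable_continuous_onI[OF cont] measurable_cong_sets[OF sH refl] by blast
  then have Fm [measurable]: "(\<lambda>g. F (act (psl2_inv g) x)) \<in> borel_measurable H"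
    using F by (rule measurable_compose)
  have phim [measurable]: "\<phi> \<in> borel_measurable H" using phi by auto
  let ?f = "\<lambda>g. \<phi> g * enn2real (F (act (psl2_inv g) x)) powr (1 / P)"
  have AEfin: "AE g in H. ennreal (\<phi> g) * (1 + F (act (psl2_inv g) x)) \<noteq> \<infinity>"
    by (rule nn_integral_PInf_AE[OF _ fin]) measurable
  have le: "ennreal (?f g) \<le> ennreal (\<phi> g) * (1 + F (act (psl2_inv g) x))" for g
  proof -
    have "?f g \<le> \<phi> g * (1 + enn2real (F (act (psl2_inv g) x)))"
      using phi P by (intro mult_left_mono powr_le_one_plus) auto
    then have "ennreal (?f g) \<le> ennreal (\<phi> g) * (1 + ennreal (enn2real (F (act (psl2_inv g) x))))"
      using phi by (simp add: ennreal_mult'[symmetric] ennreal_plus[symmetric] ennreal_leI del: ennreal_plus flip: ennreal_1)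
    also have "\<dots> \<le> ennreal (\<phi> g) * (1 + F (act (psl2_inv g) x))"
      by (intro mult_left_mono add_left_mono) (auto simp: ennreal_enn2real_if)
    finally show ?thesis .
  qed
  \<comment> \<open>A non-integrable integrand would make the convolution 0 by convention and
    destroy the lower bound.\<close>
  have int: "integrable H ?f"
  proof (rule integrableI_nonneg)
    show "?f \<in> borel_measurable H" by measurable
    show "AE g in H. 0 \<le> ?f g" using phi by simp
    have "(\<integral>\<^sup>+ g. ennreal (?f g) \<partial>H) \<le> (\<integral>\<^sup>+ g. ennreal (\<phi> g) * (1 + F (act (psl2_inv g) x)) \<partial>H)"
      by (intro nn_integral_mono le)
    also have "\<dots> < \<infinity>" using fin by (simp add: less_top)
    finally show "(\<integral>\<^sup>+ g. ennreal (?f g) \<partial>H) < \<infinity>" .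
  qed
  have "d powr (1 / P) * (\<integral>g. \<phi> g * indicator W g \<partial>H) = (\<integral>g. d powr (1 / P) * (\<phi> g * indicator W g) \<partial>H)"
    by simp
  also have "\<dots> \<le> (\<integral>g. ?f g \<partial>H)"
  proof (rule integral_mono_AE[OF _ int])
    show "integrable H (\<lambda>g. d powr (1 / P) * (\<phi> g * indicator W g))"
      using phi W by (intro integrable_mult_right integrable_real_mult_indicator) auto
    show "AE g in H. d powr (1 / P) * (\<phi> g * indicator W g) \<le> ?f g"
      using AEfin
    proof eventually_elim
      case (elim g)
      show ?case
      proof (cases "g \<in> W \<and> \<phi> g \<noteq> 0")
        case True
        then have "\<phi> g > 0" using phi(2)[of g] by simp
        then have "F (act (psl2_inv g) x) \<noteq> \<infinity>" using elim by (auto simp: ennreal_mult_eq_top_iff)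
        then have "d \<le> enn2real (F (act (psl2_inv g) x))"
          using big[of g] True d by (metis enn2real_ennreal enn2real_mono infinity_ennreal_def less_top)
        then have "d powr (1 / P) \<le> enn2real (F (act (psl2_inv g) x)) powr (1 / P)"
          using d P by (intro powr_mono2) auto
        then show ?thesis using True \<open>\<phi> g > 0\<close> by (simp add: mult.commute)
      next
        case False
        then show ?thesis using phi(2)[of g] by auto
      qed
    qed
  qed
  finally show ?thesis by (simp add: G_conv_def)
qed

text \<open>Tonelli: by invariance the integral over the space does not depend on g except through
  \<phi>(g), so the double integral is the integral of \<phi> times a finite number.\<close>

lemma AE_convolution_finite:
  assumes H: "haar_measure H" and phi: "integrable H \<phi>" "\<And>g. 0 \<le> \<phi> g"
    and U: "\<And>n::nat. open (U n)" and I: "(\<Sum>n. d n * emeasure \<mu> (U n)) < (\<infinity>::ennreal)"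
  shows "AE x in \<mu>. (\<integral>\<^sup>+ g. ennreal (\<phi> g) * (1 + (\<Sum>n. d n * indicator (U n) (act (psl2_inv g) x))) \<partial>H) \<noteq> \<infinity>"
proof -
  interpret mu: prob_space \<mu> by (rule prob_mu)
  interpret H: sigma_finite_measure H by (rule haar_sigma_finite[OF H])
  interpret pair_sigma_finite H \<mu> ..
  have sH: "sets H = sets borel" using H by (simp add: haar_measure_def)
  have phim [measurable]: "\<phi> \<in> borel_measurable H" using phi by auto
  \<comment> \<open>Openness of \<open>S n\<close> is what yields measurability for the product
    sigma-algebra; continuity of the action alone gives it for the Borel sets of the product
    space.\<close>
  define S where "S n = {(g, x). act (psl2_inv g) x \<in> U n}" for n
  have "open (S n)" for n
  proof -
    have "open ((\<lambda>(g, x). act (psl2_inv g) x) -` U n)"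
      by (rule open_vimage[OF U continuous_act_inv])
    moreover have "(\<lambda>(g, x). act (psl2_inv g) x) -` U n = S n" by (auto simp: S_def)
    ultimately show ?thesis by simp
  qed
  then have Sm [measurable]: "S n \<in> sets (H \<Otimes>\<^sub>M \<mu>)" for n
    using open_in_product_sigma_algebra[of "S n"] sets_pair_measure_cong[OF sH sets_mu] by simp
  let ?k = "\<lambda>g x. ennreal (\<phi> g) * (1 + (\<Sum>n. d n * indicator (S n) (g, x)))"
  have km [measurable]: "case_prod ?k \<in> borel_measurable (H \<Otimes>\<^sub>M \<mu>)" by measurable
  have eq: "indicator (U n) (act (psl2_inv g) x) = (indicator (S n) (g, x) :: ennreal)" for n g x
    by (simp add: S_def indicator_def)
  have Um: "act g ` U n \<in> sets \<mu>" for g n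
  proof -
    obtain A where A: "A \<in> SL2" "g = psl2_of A" by (rule psl2_cases)
    then have "act g ` U n = mact A ` U n" by (simp add: mact_def[abs_def])
    then show ?thesis using A open_mact_image[OF A(1) U] by (simp add: sets_mu)
  qed
  have inner: "(\<integral>\<^sup>+ x. ?k g x \<partial>\<mu>) = ennreal (\<phi> g) * (1 + (\<Sum>n. d n * emeasure \<mu> (U n)))" for g
  proof -
    have ind: "indicator (S n) (g, x) = (indicator (act g ` U n) x :: ennreal)" for n x
      by (simp add: S_def act_image indicator_def)
    have "(\<integral>\<^sup>+ x. ?k g x \<partial>\<mu>) = ennreal (\<phi> g) * (\<integral>\<^sup>+ x. 1 + (\<Sum>n. d n * indicator (act g ` U n) x) \<partial>\<mu>)"
      unfolding ind using Um by (intro nn_integral_cmult) simp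
    also have "(\<integral>\<^sup>+ x. 1 + (\<Sum>n. d n * indicator (act g ` U n) x) \<partial>\<mu>) = 1 + (\<integral>\<^sup>+ x. (\<Sum>n. d n * indicator (act g ` U n) x) \<partial>\<mu>)"
      using Um by (subst nn_integral_add) (auto simp: mu.emeasure_space_1)
    also have "(\<integral>\<^sup>+ x. (\<Sum>n. d n * indicator (act g ` U n) x) \<partial>\<mu>) = (\<Sum>n. d n * emeasure \<mu> (act g ` U n))"
      using Um by (subst nn_integral_suminf) (auto simp: nn_integral_cmult_indicator)
    finally show ?thesis using U invariant by simp
  qed
  have "(\<integral>\<^sup>+ x. (\<integral>\<^sup>+ g. ?k g x \<partial>H) \<partial>\<mu>) = (\<integral>\<^sup>+ g. (\<integral>\<^sup>+ x. ?k g x \<partial>\<mu>) \<partial>H)"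
    by (rule Fubini'[OF km])
  also have "\<dots> = (\<integral>\<^sup>+ g. ennreal (\<phi> g) * (1 + (\<Sum>n. d n * emeasure \<mu> (U n))) \<partial>H)"
    by (simp only: inner)
  also have "\<dots> = (\<integral>\<^sup>+ g. ennreal (\<phi> g) \<partial>H) * (1 + (\<Sum>n. d n * emeasure \<mu> (U n)))"
    by (rule nn_integral_multc) simp
  also have "\<dots> < \<infinity>"
    using I integrableD(2)[OF phi(1)] phi(2) by (auto simp: ennreal_mult_less_top less_top)
  finally have "(\<integral>\<^sup>+ x. (\<integral>\<^sup>+ g. ?k g x \<partial>H) \<partial>\<mu>) \<noteq> \<infinity>" by simp
  moreover have "(\<lambda>x. \<integral>\<^sup>+ g. ?k g x \<partial>H) \<in> borel_measurable \<mu>"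
    by measurable
  ultimately have "AE x in \<mu>. (\<integral>\<^sup>+ g. ?k g x \<partial>H) \<noteq> \<infinity>"
    by (intro nn_integral_PInf_AE)
  then show ?thesis unfolding eq .
qed

lemma sobolev_translates_lower_bound:
  assumes sob: "qualitative_sobolev act \<mu>" and e: "\<epsilon> > 0"
  shows "\<exists>c>0. \<forall>B. open B \<longrightarrow> B \<noteq> {} \<longrightarrow> c \<le> measure \<mu> (translates (SL2 \<inter> ball (mat 1) \<epsilon>) B)"
proof (rule ccontr)
  assume neg: "\<not> ?thesis"
  have small: "\<exists>B. open B \<and> B \<noteq> {} \<and> measure \<mu> (translates (SL2 \<inter> ball (mat 1) \<epsilon>) B) < c" if "c > 0" for c
    using neg that by (meson not_le)
  interpret mu: prob_space \<mu> by (rule prob_mu)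
  let ?O = "SL2 \<inter> ball (mat 1 :: real^2^2) \<epsilon>"
  obtain H p q \<phi> where H: "haar_measure H" and p1: "1 \<le> p" and pq: "p < q"
    and cont: "continuous_on UNIV \<phi>" and phi0: "\<And>g. 0 \<le> \<phi> g" and phi: "integrable H \<phi>" and ex: "\<exists>g. \<phi> g \<noteq> 0"
    and conv: "\<And>f. memLp \<mu> p f \<Longrightarrow> memLp \<mu> q (G_conv H act \<phi> f)"
    using sob unfolding qualitative_sobolev_def by metis
  have sH: "sets H = sets borel" using H by (simp add: haar_measure_def)
  have spH: "space H = UNIV" using sets_eq_imp_space_eq[OF sH] by simp
  obtain C where C: "C \<in> SL2" "\<phi> (psl2_of C) \<noteq> 0" using ex psl2_cases by metis
  \<comment> \<open>The ball makes \<open>emeasure_translates_le\<close> applicable; positivity of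
    \<phi> on \<open>W\<close> makes \<kappa> positive.\<close>
  define W where "W = psl2_of ` (SL2 \<inter> ball C 1) \<inter> {g. \<phi> g > 0}"
  have oW: "open W" unfolding W_def
    using open_Collect_less[OF continuous_on_const[of UNIV 0] cont] by (intro open_Int open_psl2_of_image) auto
  have "psl2_of C \<in> W" unfolding W_def using C phi0[of "psl2_of C"] by simp
  then have Wpos: "emeasure H W > 0" using haar_open_pos[OF H oW] by auto
  have Wm: "W \<in> sets H" using oW by (simp add: sH)
  define \<kappa> where "\<kappa> = (\<integral>g. \<phi> g * indicator W g \<partial>H)"
  have kint: "integrable H (\<lambda>g. \<phi> g * indicator W g)"
    by (rule integrable_real_mult_indicator[OF Wm phi])
  have kpos: "\<kappa> > 0"
  proof (rule ccontr)
    assume "\<not> \<kappa> > 0"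
    moreover have "\<kappa> \<ge> 0" unfolding \<kappa>_def using phi0 by (intro integral_nonneg_AE) auto
    ultimately have "\<kappa> = 0" by simp
    then have "AE g in H. \<phi> g * indicator W g = 0"
      unfolding \<kappa>_def using phi0 by (subst (asm) integral_nonneg_eq_0_iff_AE[OF kint]) auto
    then have "AE g in H. g \<notin> W"
      by eventually_elim (auto simp: W_def)
    then have "emeasure H W = 0"
      using AE_iff_measurable[of W H "\<lambda>g. g \<notin> W"] Wm spH by auto
    then show False using Wpos by simp
  qed
  obtain N :: nat where N: "\<And>B. open B \<Longrightarrow>
     emeasure \<mu> (translates (adj2 ` (SL2 \<inter> ball C 1)) (translates ?O B)) \<le> of_nat N * emeasure \<mu> (translates ?O B)"
    using emeasure_translates_le[OF e C(1)] by metis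
  define P where "P = enn2real p"
  have pfin: "p < \<infinity>" using pq by (metis infinity_ennreal_def less_top order_less_le_trans top.not_eq_extremum leI not_less_iff_gr_or_eq)
  have pP: "p = ennreal P" using pfin by (simp add: P_def less_top)
  have P1: "P \<ge> 1" using p1 pP by (metis P_def enn2real_1 enn2real_mono pfin infinity_ennreal_def)
  \<comment> \<open>For finite q this is q/p. For q = \<infinity> the value 2 is an arbitrary number
    above 1, since only the growth of the heights is used there.\<close>
  define r where "r = (if q = \<infinity> then 2 else enn2real q / P)"
  have r1: "r > 1"
  proof (cases "q = \<infinity>")
    case False
    then have "q = ennreal (enn2real q)" by (simp add: less_top)
    then have "P < enn2real q" using pq pP P1 by (metis ennreal_less_iff order_trans zero_le_one)
    then show ?thesis using False P1 by (simp add: r_def)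
  qed (simp add: r_def)
  have "\<exists>B. open B \<and> B \<noteq> {} \<and> 2 ^ n \<le> (1/2) ^ n / measure \<mu> (translates ?O B) \<and>
      2 ^ n \<le> ((1/2) ^ n / measure \<mu> (translates ?O B)) powr r * measure \<mu> (translates ?O B) \<and>
      0 < measure \<mu> (translates ?O B)" for n :: nat
  proof -
    obtain \<eta> where eta: "\<eta> > 0" "\<And>b. 0 < b \<Longrightarrow> b < \<eta> \<Longrightarrow> 2 ^ n \<le> (1/2) ^ n / b"
      "\<And>b. 0 < b \<Longrightarrow> b < \<eta> \<Longrightarrow> 2 ^ n \<le> ((1/2) ^ n / b) powr r * b"
      using small_measure_blowup[OF r1] by metis
    obtain B where B: "open B" "B \<noteq> {}" "measure \<mu> (translates ?O B) < \<eta>"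
      using small[OF eta(1)] by blast
    obtain b where "b \<in> B" using B by auto
    then have "b \<in> translates ?O B" unfolding translates_def using e by (intro UN_I[of "mat 1"]) force+
    then have "0 < emeasure \<mu> (translates ?O B)"
      using B by (intro full_support open_translates) auto
    then have "0 < measure \<mu> (translates ?O B)" by (simp add: mu.emeasure_eq_measure)
    then show ?thesis using B eta by blast
  qed
  then obtain B' where B': "\<And>n::nat. open (B' n)"
    and b2: "\<And>n. 2 ^ n \<le> (1/2) ^ n / measure \<mu> (translates ?O (B' n))"
    and br: "\<And>n. 2 ^ n \<le> ((1/2) ^ n / measure \<mu> (translates ?O (B' n))) powr r * measure \<mu> (translates ?O (B' n))"
    and bpos: "\<And>n. 0 < measure \<mu> (translates ?O (B' n))"
    by metis
  define B where "B n = translates ?O (B' n)" for n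
  define U where "U n = translates (adj2 ` (SL2 \<inter> ball C 1)) (B n)" for n
  \<comment> \<open>Normalised so that d n times the measure of \<open>B n\<close> is (1/2)^n. As
    \<open>U n\<close> costs only the factor N more, the integral of \<open>F\<close> is bounded by
    a geometric series.\<close>
  define d where "d n = (1/2) ^ n / measure \<mu> (B n)" for n
  have oB: "open (B n)" for n unfolding B_def using B' by (intro open_translates) auto
  have oU: "open (U n)" for n unfolding U_def using oB by (intro open_translates) auto
  have dpos: "d n > 0" for n using bpos[of n] by (simp add: d_def B_def)
  define F where "F x = (\<Sum>n. ennreal (d n) * indicator (U n) x)" for x
  have [measurable]: "U n \<in> sets borel" for n using oU by simp
  have Fm: "F \<in> borel_measurable borel" unfolding F_def by measurable
  have Fge: "ennreal (d n) \<le> F x" if "x \<in> U n" for n x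
  proof -
    have "(\<Sum>k\<in>{n}. ennreal (d k) * indicator (U k) x) \<le> F x"
      unfolding F_def by (rule sum_le_suminf) auto
    then show ?thesis using that by simp
  qed
  have I: "(\<Sum>n. ennreal (d n) * emeasure \<mu> (U n)) < \<infinity>"
  proof -
    have "ennreal (d n) * emeasure \<mu> (U n) \<le> ennreal (real N * (1/2) ^ n)" for n
    proof -
      have "emeasure \<mu> (U n) \<le> of_nat N * emeasure \<mu> (B n)" using N[OF B'] by (simp add: U_def B_def)
      also have "\<dots> = ennreal (real N * measure \<mu> (B n))"
        by (simp add: mu.emeasure_eq_measure ennreal_mult' ennreal_of_nat_eq_real_of_nat)
      finally have "ennreal (d n) * emeasure \<mu> (U n) \<le> ennreal (d n) * ennreal (real N * measure \<mu> (B n))"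
        by (rule mult_left_mono) simp
      also have "\<dots> = ennreal (d n * (real N * measure \<mu> (B n)))"
        using dpos[of n] by (simp add: ennreal_mult')
      also have "d n * (real N * measure \<mu> (B n)) = real N * (1/2) ^ n"
        using bpos[of n] by (simp add: d_def B_def)
      finally show ?thesis .
    qed
    then have "(\<Sum>n. ennreal (d n) * emeasure \<mu> (U n)) \<le> (\<Sum>n. ennreal (real N * (1/2) ^ n))"
      by (intro suminf_le) auto
    also have "\<dots> = ennreal (\<Sum>n. real N * (1/2) ^ n)"
      by (intro suminf_ennreal2 summable_mult summable_geometric) auto
    finally show ?thesis by (simp add: order_le_less_trans less_top)
  qed
  \<comment> \<open>\<^term>\<open>F\<close> may be infinite on a null set, where \<^const>\<open>enn2real\<close> turns it into 0.\<close>
  define f where "f x = enn2real (F x) powr (1 / P)" for x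
  have Umu [measurable]: "U n \<in> sets \<mu>" for n by (simp add: sets_mu)
  have Fmu: "F \<in> borel_measurable \<mu>" using Fm measurable_cong_sets[OF sets_mu refl] by blast
  have "memLp \<mu> p f"
    unfolding memLp_def
  proof (intro conjI)
    show "f \<in> borel_measurable \<mu>" unfolding f_def using Fmu by measurable
    have "(\<integral>\<^sup>+ x. ennreal (\<bar>f x\<bar> powr enn2real p) \<partial>\<mu>) \<le> (\<integral>\<^sup>+ x. F x \<partial>\<mu>)"
    proof (rule nn_integral_mono)
      fix x
      have "\<bar>f x\<bar> powr enn2real p = enn2real (F x)"
        using P1 unfolding f_def P_def[symmetric] by (simp add: powr_powr)
      then show "ennreal (\<bar>f x\<bar> powr enn2real p) \<le> F x" by (simp add: ennreal_enn2real_if)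
    qed
    also have "\<dots> = (\<Sum>n. ennreal (d n) * emeasure \<mu> (U n))"
      unfolding F_def by (subst nn_integral_suminf) (auto simp: nn_integral_cmult_indicator sets_mu Umu)
    finally have "(\<integral>\<^sup>+ x. ennreal (\<bar>f x\<bar> powr enn2real p) \<partial>\<mu>) < \<infinity>" using I by simp
    then show "if p = \<infinity> then \<exists>C. AE x in \<mu>. \<bar>f x\<bar> \<le> C else (\<integral>\<^sup>+ x. ennreal (\<bar>f x\<bar> powr enn2real p) \<partial>\<mu>) < \<infinity>"
      using pfin by simp
  qed
  then have Lq: "memLp \<mu> q (G_conv H act \<phi> f)" by (rule conv)
  have "AE x in \<mu>. (\<integral>\<^sup>+ g. ennreal (\<phi> g) * (1 + F (act (psl2_inv g) x)) \<partial>H) \<noteq> \<infinity>"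
    unfolding F_def by (rule AE_convolution_finite[OF H phi phi0 oU I])
  \<comment> \<open>For g in \<open>W\<close> and x in \<open>B n\<close> the point g^-1 x lies in
    \<open>U n\<close>, where F \<ge> d n. The discarded null set is the same for all n.\<close>
  then have low: "AE x in \<mu>. \<forall>n. x \<in> B n \<longrightarrow> d n powr (1 / P) * \<kappa> \<le> G_conv H act \<phi> f x"
  proof eventually_elim
    case (elim x)
    show ?case
    proof (intro allI impI)
      fix n assume x: "x \<in> B n"
      show "d n powr (1 / P) * \<kappa> \<le> G_conv H act \<phi> f x"
        unfolding \<kappa>_def f_def
      proof (rule G_conv_lower_bound[OF H phi phi0 Fm P1 _ elim Wm])
        show "d n \<ge> 0" using dpos[of n] by simp
        fix g assume "g \<in> W"
        then obtain A where A: "A \<in> SL2 \<inter> ball C 1" "g = psl2_of A" by (auto simp: W_def)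
        then have "act (psl2_inv g) x = mact (adj2 A) x" by (simp add: mact_def)
        then have "act (psl2_inv g) x \<in> U n" using A x unfolding U_def translates_def by blast
        then show "ennreal (d n) \<le> F (act (psl2_inv g) x)" by (rule Fge)
      qed
    qed
  qed
  show False
  proof (cases "q = \<infinity>")
    case True
    then obtain M where M: "AE x in \<mu>. \<bar>G_conv H act \<phi> f x\<bar> \<le> M" using Lq by (auto simp: memLp_def)
    \<comment> \<open>The essential bound must respect the values on \<open>B n\<close>, a set of
      positive measure; this will contradict d n \<ge> 2^n.\<close>
    have bd: "d n powr (1 / P) * \<kappa> \<le> M" for n
    proof (rule ccontr)
      assume *: "\<not> d n powr (1 / P) * \<kappa> \<le> M"
      have "AE x in \<mu>. x \<notin> B n"
        using low M by eventually_elim (use * in fastforce)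
      then have "emeasure \<mu> (B n) = 0"
        using AE_iff_measurable[of "B n" \<mu> "\<lambda>x. x \<notin> B n"] oB space_mu by (auto simp: sets_mu)
      then show False using bpos[of n] by (simp add: B_def mu.emeasure_eq_measure)
    qed
    have M0: "M / \<kappa> > 0"
      using bd[of 0] dpos[of 0] kpos by (smt (verit, best) mult_pos_pos powr_gt_zero divide_pos_pos)
    obtain n where n: "(M / \<kappa>) powr P < 2 ^ n" using real_arch_pow[of 2 "(M / \<kappa>) powr P"] by auto
    also have "2 ^ n \<le> d n" using b2[of n] by (simp add: d_def B_def)
    also have "d n = (d n powr (1 / P)) powr P" using dpos[of n] P1 by (simp add: powr_powr)
    also have "\<dots> \<le> (M / \<kappa>) powr P"
      using bd[of n] kpos P1 by (intro powr_mono2) (auto simp: field_simps)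
    finally show False by simp
  next
    case False
    define Q where "Q = enn2real q"
    have rQ: "r = Q / P" using False by (simp add: r_def Q_def)
    have Qpos: "Q > 0" using r1 rQ P1 by (metis divide_nonpos_pos less_le_not_le linorder_not_less order_less_trans zero_less_one less_le_trans not_one_less_zero)
    define L where "L = (\<integral>\<^sup>+ x. ennreal (\<bar>G_conv H act \<phi> f x\<bar> powr Q) \<partial>\<mu>)"
    have Lfin: "L < \<infinity>" using Lq False by (simp add: memLp_def L_def Q_def)
    \<comment> \<open>Restricting the integral to \<open>B n\<close> leaves \<kappa>^Q d_n^r
      \<mu>(B_n), because Q/P = r, and \<open>br\<close> bounds this below.\<close>
    have ge: "ennreal (\<kappa> powr Q * 2 ^ n) \<le> L" for n
    proof -
      have "\<kappa> powr Q * 2 ^ n \<le> \<kappa> powr Q * (d n powr r * measure \<mu> (B n))"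
        using br[of n] by (intro mult_left_mono) (auto simp: d_def B_def)
      also have "\<dots> = (d n powr (1 / P) * \<kappa>) powr Q * measure \<mu> (B n)"
        using dpos[of n] kpos by (simp add: powr_mult powr_powr rQ)
      finally have "ennreal (\<kappa> powr Q * 2 ^ n) \<le> ennreal ((d n powr (1 / P) * \<kappa>) powr Q * measure \<mu> (B n))"
        by (rule ennreal_leI)
      also have "\<dots> = (\<integral>\<^sup>+ x. ennreal ((d n powr (1 / P) * \<kappa>) powr Q) * indicator (B n) x \<partial>\<mu>)"
        using oB by (simp add: nn_integral_cmult_indicator sets_mu mu.emeasure_eq_measure ennreal_mult')
      also have "\<dots> \<le> L" unfolding L_def
      proof (rule nn_integral_mono_AE)
        show "AE x in \<mu>. ennreal ((d n powr (1 / P) * \<kappa>) powr Q) * indicator (B n) x \<le> ennreal (\<bar>G_conv H act \<phi> f x\<bar> powr Q)"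
          using low
        proof eventually_elim
          case (elim x)
          show ?case
          proof (cases "x \<in> B n")
            case True
            then have "d n powr (1 / P) * \<kappa> \<le> \<bar>G_conv H act \<phi> f x\<bar>" using elim by fastforce
            then have "(d n powr (1 / P) * \<kappa>) powr Q \<le> \<bar>G_conv H act \<phi> f x\<bar> powr Q"
              using kpos Qpos by (intro powr_mono2) auto
            then show ?thesis using True by (simp add: ennreal_leI)
          qed simp
        qed
      qed
      finally show ?thesis .
    qed
    obtain l where l: "L = ennreal l" "l \<ge> 0" using Lfin by (cases L) auto
    obtain n where "l / \<kappa> powr Q < 2 ^ n" using real_arch_pow[of 2 "l / \<kappa> powr Q"] by auto
    then have "l < \<kappa> powr Q * 2 ^ n" using kpos by (simp add: field_simps)
    then show False using ge[of n] l by (simp add: ennreal_le_iff)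
  qed
qed

end

subsection \<open>Orbits and stabilisers\<close>

text \<open>Two closed sets with empty interior have a union with empty interior in every
  topological space; induction extends this to finite families.\<close>

lemma finite_closed_cover_interior:
  fixes f :: "'i \<Rightarrow> 'a::topological_space set"
  assumes "finite I" "\<And>i. i \<in> I \<Longrightarrow> closed (f i)" "(\<Union>i\<in>I. f i) = UNIV"
  obtains i where "i \<in> I" "interior (f i) \<noteq> {}"
proof -
  have "interior (\<Union>i\<in>I. f i) = {}" if "\<forall>i\<in>I. interior (f i) = {}"
    using assms(1,2) that
  proof (induction I rule: finite_induct)
    case (insert i I)
    then show ?case using interior_closed_Un_empty_interior[of "f i" "\<Union>i\<in>I. f i"] by simp
  qed simp
  then show ?thesis using assms(3) that by fastforce
qed

lemma compact_separation_t2: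
  fixes S T :: "'a::t2_space set"
  assumes "compact S" "compact T" "S \<inter> T = {}"
  obtains U V where "open U" "open V" "S \<subseteq> U" "T \<subseteq> V" "U \<inter> V = {}"
proof -
  have "Hausdorff_space (euclidean :: 'a topology)"
    unfolding Hausdorff_space_def by (simp add: disjnt_def) (metis separation_t2)
  then show ?thesis
    using assms that unfolding Hausdorff_space_compact_sets by (simp add: disjnt_def) metis
qed

lemma norm_adj2: "norm (adj2 A) = norm A"
  by (simp add: norm_eq inner_vec_def sum_2)

lemma norm_adj2_diff_one: "norm (adj2 A - mat 1) = norm (A - mat 1)"
proof -
  have "adj2 A - mat 1 = adj2 (A - mat 1)" by (simp add: matrix2_eq_iff)
  then show ?thesis by (simp add: norm_adj2)
qed

section \<open>Separation of orbit pieces, open orbits, stabilisers\<close>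

context psl2_space
begin

text \<open>The tube lemma: compactness of \<open>V\<close> gives one neighbourhood of x that works
  for all of \<open>V\<close>.\<close>

lemma translates_tube:
  assumes V: "compact V" "V \<subseteq> SL2" and P: "open P" "\<And>A. A \<in> V \<Longrightarrow> mact A x \<in> P"
  obtains B where "open B" "x \<in> B" "translates V B \<subseteq> P"
proof -
  have "continuous_on (UNIV \<times> SL2) (\<lambda>z. mact (snd z) (fst z))"
    by (rule continuous_on_mact[OF continuous_on_snd[OF continuous_on_id] continuous_on_fst[OF continuous_on_id]]) auto
  then obtain W where W: "open W" "W \<inter> (UNIV \<times> SL2) = (\<lambda>z. mact (snd z) (fst z)) -` P \<inter> (UNIV \<times> SL2)"
    using P(1) unfolding continuous_on_open_invariant by blast
  have "{x} \<times> V \<subseteq> W"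
  proof
    fix z assume "z \<in> {x} \<times> V"
    then obtain A where A: "z = (x, A)" "A \<in> V" by auto
    then have "z \<in> (\<lambda>z. mact (snd z) (fst z)) -` P \<inter> (UNIV \<times> SL2)" using P V by auto
    then show "z \<in> W" using W by auto
  qed
  then obtain B where B: "x \<in> B" "open B" "B \<times> V \<subseteq> W"
    using Elementary_Topology.tube_lemma[OF V(1) W(1)] by metis
  have "translates V B \<subseteq> P"
  proof
    fix y assume "y \<in> translates V B"
    then obtain A b where A: "A \<in> V" "b \<in> B" "y = mact A b" by (auto simp: translates_def)
    then have "(b, A) \<in> W \<inter> (UNIV \<times> SL2)" using B V by auto
    then show "y \<in> P" using W A by auto
  qed
  then show ?thesis using that B by blast
qed

text \<open>The pieces Vx and Vy may be null sets. Passing to disjoint thickened open sets makes the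
  lower bound on measures applicable.\<close>

lemma translates_separated:
  assumes V: "compact V" "V \<subseteq> SL2" and ne: "\<And>A B. A \<in> V \<Longrightarrow> B \<in> V \<Longrightarrow> mact A x \<noteq> mact B y"
  obtains B B' where "open B" "open B'" "x \<in> B" "y \<in> B'" "translates V B \<inter> translates V B' = {}"
proof -
  have "(\<lambda>A. mact A x) ` V \<inter> (\<lambda>A. mact A y) ` V = {}" using ne by auto
  then obtain P Q where PQ: "open P" "open Q" "(\<lambda>A. mact A x) ` V \<subseteq> P" "(\<lambda>A. mact A y) ` V \<subseteq> Q" "P \<inter> Q = {}"
    using compact_separation_t2[OF compact_orbit[OF V] compact_orbit[OF V]] by metis
  obtain B where B: "open B" "x \<in> B" "translates V B \<subseteq> P"
    using translates_tube[OF V PQ(1)] PQ(3) by (metis image_subset_iff)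
  obtain B' where B': "open B'" "y \<in> B'" "translates V B' \<subseteq> Q"
    using translates_tube[OF V PQ(2)] PQ(4) by (metis image_subset_iff)
  show ?thesis using that[OF B(1) B'(1) B(2) B'(2)] B(3) B'(3) PQ(5) by blast
qed

lemma open_orbitI:
  assumes Q: "open Q" "q \<in> Q" "Q \<subseteq> (\<lambda>A. mact A x) ` SL2"
  shows "open ((\<lambda>A. mact A x) ` SL2)"
proof (rule topological_space_class.openI)
  fix y assume "y \<in> (\<lambda>A. mact A x) ` SL2"
  then obtain A where A: "A \<in> SL2" "y = mact A x" by auto
  obtain A0 where A0: "A0 \<in> SL2" "q = mact A0 x" using Q by auto
  let ?C = "A ** adj2 A0"
  have C: "?C \<in> SL2" using A A0 by simp
  have "y = mact ?C q" using A A0 by (simp add: mact_mult)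
  then have "y \<in> mact ?C ` Q" using Q by auto
  moreover have "mact ?C ` Q \<subseteq> (\<lambda>A. mact A x) ` SL2"
  proof
    fix z assume "z \<in> mact ?C ` Q"
    then obtain w where "w \<in> Q" "z = mact ?C w" by auto
    moreover then obtain D where "D \<in> SL2" "w = mact D x" using Q by auto
    ultimately have "z = mact (?C ** D) x" "?C ** D \<in> SL2" using C by (simp_all add: mact_mult)
    then show "z \<in> (\<lambda>A. mact A x) ` SL2" by blast
  qed
  ultimately show "\<exists>T. open T \<and> y \<in> T \<and> T \<subseteq> (\<lambda>A. mact A x) ` SL2"
    using open_mact_image[OF C Q(1)] by blast
qed

text \<open>The full preimage in \<open>SL2\<close> of the stabiliser, hence a matrix group that
  always contains \<open>- mat 1\<close>.\<close>

definition stab :: "'x \<Rightarrow> (real^2^2) set" where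
  "stab x = {A \<in> SL2. mact A x = x}"

lemma stab_subgroup: "SL2_subgroup (stab x)"
  unfolding SL2_subgroup_def stab_def by (auto simp: mact_mult) (metis mact_adj2(1))

lemma stab_closed: "closed (stab x)"
proof -
  have "closedin (top_of_set SL2) (SL2 \<inter> (\<lambda>A. mact A x) -` {x})"
    by (rule continuous_closedin_preimage[OF continuous_on_mact_orbit]) auto
  moreover have "SL2 \<inter> (\<lambda>A. mact A x) -` {x} = stab x" by (auto simp: stab_def)
  ultimately show ?thesis using closedin_closed_trans[OF _ closed_SL2] by metis
qed

lemma conj_set_stab:
  assumes "h \<in> SL2"
  shows "conj_set h (stab x) = stab (mact h x)"
proof -
  have "adj2 h ** A ** h \<in> stab x \<longleftrightarrow> mact A (mact h x) = mact h x" if "A \<in> SL2" for A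
  proof -
    have "mact (adj2 h ** A ** h) x = mact (adj2 h) (mact A (mact h x))"
      using assms that by (simp add: mact_mult)
    also have "\<dots> = x \<longleftrightarrow> mact A (mact h x) = mact h x"
      using assms mact_eq_iff[of "adj2 h" "mact A (mact h x)" x] by simp
    finally show ?thesis using assms that by (simp add: stab_def)
  qed
  then show ?thesis by (auto simp: conj_set_def stab_def[of "mact h x"])
qed

end

section \<open>Transitivity, recurrence and the coset space\<close>

context psl2_prob_space
begin

text \<open>A maximal \<open>F\<close> with pairwise disjoint pieces Vx exists because its
  cardinality is at most 1/c; maximality makes Vy meet some Vx, that is Ay = Bx. That
  \<open>F\<close> lies inside \<open>Y\<close> matters when \<open>Y\<close> is an orbit.\<close>

lemma sobolev_finite_cover:
  assumes sob: "qualitative_sobolev act \<mu>" and e: "\<epsilon> > 0"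
    and Y: "open Y"
  obtains F where "finite F" "F \<subseteq> Y"
    "\<And>y. y \<in> Y \<Longrightarrow> \<exists>x\<in>F. \<exists>A\<in>SL2 \<inter> cball (mat 1) \<epsilon>. \<exists>B\<in>SL2 \<inter> cball (mat 1) \<epsilon>. y = mact (adj2 A ** B) x"
proof -
  interpret mu: prob_space \<mu> by (rule prob_mu)
  define V where "V = SL2 \<inter> cball (mat 1 :: real^2^2) \<epsilon>"
  let ?O = "SL2 \<inter> ball (mat 1 :: real^2^2) \<epsilon>"
  have V: "compact V" "V \<subseteq> SL2" unfolding V_def by (auto intro: compact_SL2_cball)
  have oneV: "mat 1 \<in> V" using e by (simp add: V_def)
  obtain c where c: "c > 0" "\<And>B. open B \<Longrightarrow> B \<noteq> {} \<Longrightarrow> c \<le> measure \<mu> (translates ?O B)"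
    using sobolev_translates_lower_bound[OF sob e] by metis
  define good where "good F \<longleftrightarrow> finite F \<and> F \<subseteq> Y \<and> (\<forall>x\<in>F. \<forall>y\<in>F. x \<noteq> y \<longrightarrow> (\<forall>A\<in>V. \<forall>B\<in>V. mact A x \<noteq> mact B y))" for F
  have bound: "real (card F) * c \<le> 1" if "good F" for F
  proof -
    have "\<forall>x y. \<exists>B B'. x \<in> F \<and> y \<in> F \<and> x \<noteq> y \<longrightarrow>
        open B \<and> open B' \<and> x \<in> B \<and> y \<in> B' \<and> translates V B \<inter> translates V B' = {}"
      using that translates_separated[OF V] unfolding good_def by metis
    then obtain L R where LR: "\<And>x y. x \<in> F \<Longrightarrow> y \<in> F \<Longrightarrow> x \<noteq> y \<Longrightarrow>
        open (L x y) \<and> open (R x y) \<and> x \<in> L x y \<and> y \<in> R x y \<and> translates V (L x y) \<inter> translates V (R x y) = {}"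
      by metis
    \<comment> \<open>Each pair of points is separated in both orders, so \<open>B x\<close> must
      lie in \<open>L x y\<close>, where x comes first, and in \<open>R y x\<close>, where it comes
      second.\<close>
    define B where "B x = (\<Inter>y\<in>F - {x}. L x y \<inter> R y x)" for x
    have fin: "finite F" using that by (simp add: good_def)
    have oB: "open (B x)" if "x \<in> F" for x
      unfolding B_def using fin LR that by (intro open_INT) auto
    have xB: "x \<in> B x" if "x \<in> F" for x unfolding B_def using LR that by auto
    have sub: "translates ?O (B x) \<subseteq> translates V Z" if "B x \<subseteq> Z" for x Z
      unfolding translates_def V_def using that by fastforce
    have "disjoint_family_on (\<lambda>x. translates ?O (B x)) F"
      unfolding disjoint_family_on_def
    proof (intro ballI impI)
      fix x y assume xy: "x \<in> F" "y \<in> F" "x \<noteq> y"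
      have "B x \<subseteq> L x y" "B y \<subseteq> R x y" using xy by (auto simp: B_def)
      then have "translates ?O (B x) \<subseteq> translates V (L x y)" "translates ?O (B y) \<subseteq> translates V (R x y)"
        using sub by blast+
      then show "translates ?O (B x) \<inter> translates ?O (B y) = {}" using LR[OF xy] by blast
    qed
    then have "(\<Sum>x\<in>F. measure \<mu> (translates ?O (B x))) = measure \<mu> (\<Union>x\<in>F. translates ?O (B x))"
      using fin oB by (intro mu.finite_measure_finite_Union[symmetric])
        (auto simp: sets_mu intro!: borel_open open_translates)
    also have "\<dots> \<le> 1" by (rule mu.prob_le_1)
    finally have "(\<Sum>x\<in>F. measure \<mu> (translates ?O (B x))) \<le> 1" .
    moreover have "(\<Sum>x\<in>F. c) \<le> (\<Sum>x\<in>F. measure \<mu> (translates ?O (B x)))"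
      using oB xB by (intro sum_mono c(2)) auto
    ultimately show ?thesis by simp
  qed
  obtain F where F: "good F" and max: "\<And>F'. good F' \<Longrightarrow> card F' \<le> card F"
  proof -
    obtain m :: nat where m: "1 / c < m" using reals_Archimedean2 by blast
    have "card F < m" if "good F" for F
    proof -
      have "real (card F) \<le> 1 / c" using bound[OF that] c(1) by (simp add: field_simps)
      then show ?thesis using m by linarith
    qed
    moreover have "good {}" by (simp add: good_def)
    ultimately have "\<exists>F. good F \<and> (\<forall>F'. good F' \<longrightarrow> card F' \<le> card F)"
      by (intro Lattices_Big.ex_has_greatest_nat[of good "{}" card m]) auto
    then show ?thesis using that by blast
  qed
  show ?thesis
  proof (rule that)
    show "finite F" "F \<subseteq> Y" using F by (auto simp: good_def)
    fix y assume y: "y \<in> Y"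
    have "\<exists>x\<in>F. \<exists>A\<in>V. \<exists>B\<in>V. mact A y = mact B x"
    proof (rule ccontr)
      assume no: "\<not> ?thesis"
      then have "y \<notin> F" using oneV by blast
      have "good (insert y F)" using F y no unfolding good_def by (simp, metis)
      from max[OF this] show False using \<open>y \<notin> F\<close> F by (simp add: good_def)
    qed
    then obtain x A B where xAB: "x \<in> F" "A \<in> V" "B \<in> V" "mact A y = mact B x" by blast
    then have "y = mact (adj2 A ** B) x" using V(2) by (simp add: mact_eq_iff mact_mult subset_iff)
    then show "\<exists>x\<in>F. \<exists>A\<in>SL2 \<inter> cball (mat 1) \<epsilon>. \<exists>B\<in>SL2 \<inter> cball (mat 1) \<epsilon>. y = mact (adj2 A ** B) x"
      using xAB unfolding V_def by blast
  qed
qed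

lemma sobolev_compact_cover:
  assumes sob: "qualitative_sobolev act \<mu>" and Y: "open Y"
  obtains F K where "finite F" "F \<subseteq> Y" "compact K" "K \<subseteq> SL2" "Y \<subseteq> (\<Union>x\<in>F. (\<lambda>A. mact A x) ` K)"
proof -
  define V where "V = SL2 \<inter> cball (mat 1 :: real^2^2) 1"
  define K where "K = (\<lambda>(A, B). adj2 A ** B) ` (V \<times> V)"
  have "compact K" unfolding K_def V_def
    by (intro compact_continuous_image compact_Times compact_SL2_cball)
      (auto intro!: continuous_intros simp: case_prod_beta')
  moreover have "K \<subseteq> SL2" by (auto simp: K_def V_def)
  moreover obtain F where F: "finite F" "F \<subseteq> Y"
    "\<And>y. y \<in> Y \<Longrightarrow> \<exists>x\<in>F. \<exists>A\<in>V. \<exists>B\<in>V. y = mact (adj2 A ** B) x"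
    using sobolev_finite_cover[OF sob zero_less_one Y] unfolding V_def by metis
  moreover have "Y \<subseteq> (\<Union>x\<in>F. (\<lambda>A. mact A x) ` K)"
  proof
    fix y assume "y \<in> Y"
    then obtain x A B where "x \<in> F" "A \<in> V" "B \<in> V" "y = mact (adj2 A ** B) x" using F by blast
    then show "y \<in> (\<Union>x\<in>F. (\<lambda>A. mact A x) ` K)" unfolding K_def by force
  qed
  ultimately show ?thesis using that by blast
qed

lemma sobolev_transitive:
  assumes sob: "qualitative_sobolev act \<mu>" and conn: "connected (UNIV :: 'x set)"
  obtains A where "A \<in> SL2" "y = mact A x"
proof -
  obtain F K where F: "finite F" and K: "compact K" "K \<subseteq> SL2" and cov: "UNIV \<subseteq> (\<Union>x\<in>F. (\<lambda>A. mact A x) ` K)"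
    using sobolev_compact_cover[OF sob open_UNIV] by metis
  have "closed ((\<lambda>A. mact A z) ` K)" for z using compact_orbit[OF K] by (rule compact_imp_closed)
  then obtain z where z: "interior ((\<lambda>A. mact A z) ` K) \<noteq> {}"
    using finite_closed_cover_interior[OF F, of "\<lambda>x. (\<lambda>A. mact A x) ` K"] cov by (metis top.extremum_uniqueI)
  define Y where "Y = (\<lambda>A. mact A z) ` SL2"
  obtain q where q: "q \<in> interior ((\<lambda>A. mact A z) ` K)" using z by auto
  have oY: "open Y" unfolding Y_def
    by (rule open_orbitI[OF open_interior q])
      (use interior_subset K(2) in blast)
  \<comment> \<open>The cover is applied a second time, inside the orbit: since F' lies in
    \<open>Y\<close>, the compact pieces stay in \<open>Y\<close> and their finite union is exactly
    \<open>Y\<close>.\<close>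
  obtain F' K' where F': "finite F'" "F' \<subseteq> Y" and K': "compact K'" "K' \<subseteq> SL2" and cov': "Y \<subseteq> (\<Union>x\<in>F'. (\<lambda>A. mact A x) ` K')"
    using sobolev_compact_cover[OF sob oY] by metis
  have "(\<Union>x\<in>F'. (\<lambda>A. mact A x) ` K') \<subseteq> Y"
  proof
    fix w assume "w \<in> (\<Union>x\<in>F'. (\<lambda>A. mact A x) ` K')"
    then obtain x A where "x \<in> F'" "A \<in> K'" "w = mact A x" by auto
    moreover then obtain B where "B \<in> SL2" "x = mact B z" using F' by (auto simp: Y_def)
    ultimately have "w = mact (A ** B) z" "A ** B \<in> SL2" using K' by (auto simp: mact_mult subset_iff)
    then show "w \<in> Y" unfolding Y_def by blast
  qed
  then have "Y = (\<Union>x\<in>F'. (\<lambda>A. mact A x) ` K')" using cov' by blast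
  then have "compact Y" using F' compact_orbit[OF K'] by (auto intro: compact_UN)
  then have cY: "closed Y" by (rule compact_imp_closed)
  have "z \<in> Y" unfolding Y_def by (intro image_eqI[of _ _ "mat 1"]) auto
  then have "Y = UNIV" using conn oY cY unfolding connected_clopen by (auto simp: closedin_closed_eq)
  then obtain A B where "A \<in> SL2" "B \<in> SL2" "x = mact A z" "y = mact B z" unfolding Y_def by blast
  then have "y = mact (B ** adj2 A) x" "B ** adj2 A \<in> SL2" by (simp_all add: mact_mult)
  then show ?thesis using that by blast
qed

text \<open>The compact cover has several base points y; by transitivity y = h(y) x, so multiplying
  \<open>K\<close> on the right by h(y) moves them all to x.\<close>

lemma sobolev_compact_orbit:
  assumes sob: "qualitative_sobolev act \<mu>" and conn: "connected (UNIV :: 'x set)"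
  obtains K where "compact K" "K \<subseteq> SL2" "(\<lambda>A. mact A x) ` K = UNIV"
proof -
  obtain F K where F: "finite F" and K: "compact K" "K \<subseteq> SL2" and cov: "UNIV \<subseteq> (\<Union>x\<in>F. (\<lambda>A. mact A x) ` K)"
    using sobolev_compact_cover[OF sob open_UNIV] by metis
  have "\<forall>y. \<exists>A. A \<in> SL2 \<and> mact A x = y"
  proof
    fix y
    obtain A where "A \<in> SL2" "y = mact A x" by (rule sobolev_transitive[OF sob conn])
    then show "\<exists>A. A \<in> SL2 \<and> mact A x = y" by (intro exI[of _ A]) simp
  qed
  then obtain h where h: "\<And>y. h y \<in> SL2" "\<And>y. mact (h y) x = y"
    unfolding choice_iff by blast
  define K' where "K' = (\<Union>y\<in>F. (\<lambda>A. A ** h y) ` K)"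
  have "compact ((\<lambda>A. A ** h y) ` K)" for y
    by (intro compact_continuous_image K continuous_on_matrix_mult continuous_on_id continuous_on_const)
  then have "compact K'" unfolding K'_def using F by (intro compact_UN)
  moreover have "K' \<subseteq> SL2" unfolding K'_def using K h by auto
  moreover have "(\<lambda>A. mact A x) ` K' = UNIV"
  proof (intro equalityI subset_UNIV subsetI)
    fix w :: 'x
    obtain y A where y: "y \<in> F" "A \<in> K" "w = mact A y" using cov by blast
    then have "w = mact (A ** h y) x" using K h by (auto simp: mact_mult subset_iff)
    then show "w \<in> (\<lambda>A. mact A x) ` K'" unfolding K'_def using y by blast
  qed
  ultimately show ?thesis using that by blast
qed

text \<open>An open mapping theorem for the orbit map. Finitely many translates of the compact piece
  Vx cover the space, so one has interior; moving an interior point vx back to x puts x into the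
  interior of V^-1 V x.\<close>

lemma sobolev_orbit_nhd:
  assumes sob: "qualitative_sobolev act \<mu>" and conn: "connected (UNIV :: 'x set)" and e: "\<epsilon> > 0"
  shows "x \<in> interior ((\<lambda>A. mact A x) ` (SL2 \<inter> ball (mat 1) \<epsilon>))"
proof -
  \<comment> \<open>Chosen so that V^-1 V lies in the \<epsilon>-ball.\<close>
  obtain \<delta> where d: "\<delta> > 0" "\<And>v w. norm (v - mat 1) \<le> \<delta> \<Longrightarrow> norm (w - mat 1) \<le> \<delta> \<Longrightarrow> adj2 v ** w \<in> ball (mat 1) \<epsilon>"
  proof -
    have "open ((\<lambda>z::(real^2^2)\<times>(real^2^2). adj2 (fst z) ** snd z) -` ball (mat 1) \<epsilon>)"
      by (intro open_vimage continuous_intros) auto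
    moreover have "(mat 1, mat 1) \<in> (\<lambda>z::(real^2^2)\<times>(real^2^2). adj2 (fst z) ** snd z) -` ball (mat 1) \<epsilon>"
      using e by simp
    ultimately obtain P Q where PQ: "open P" "open Q" "mat 1 \<in> P" "mat 1 \<in> Q"
      "P \<times> Q \<subseteq> (\<lambda>z::(real^2^2)\<times>(real^2^2). adj2 (fst z) ** snd z) -` ball (mat 1) \<epsilon>"
      by (rule open_prod_elim) auto
    have "open (P \<inter> Q)" "mat 1 \<in> P \<inter> Q" using PQ by auto
    then obtain \<delta> where d: "\<delta> > 0" "cball (mat 1) \<delta> \<subseteq> P \<inter> Q"
      using open_contains_cball by blast
    have "adj2 v ** w \<in> ball (mat 1) \<epsilon>" if "norm (v - mat 1) \<le> \<delta>" "norm (w - mat 1) \<le> \<delta>" for v w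
    proof -
      have "v \<in> cball (mat 1) \<delta>" "w \<in> cball (mat 1) \<delta>" using that by (auto simp: dist_norm norm_minus_commute)
      then have "(v, w) \<in> P \<times> Q" using d by auto
      then show ?thesis using PQ(5) by auto
    qed
    then show ?thesis using that d(1) by blast
  qed
  define V where "V = SL2 \<inter> cball (mat 1 :: real^2^2) \<delta>"
  have V: "compact V" "V \<subseteq> SL2" unfolding V_def by (auto intro: compact_SL2_cball)
  obtain K where K: "compact K" "K \<subseteq> SL2" "(\<lambda>A. mact A x) ` K = UNIV"
    using sobolev_compact_orbit[OF sob conn] by metis
  obtain F where F: "finite F" "F \<subseteq> SL2" "\<And>A. A \<in> K \<Longrightarrow> \<exists>h\<in>F. adj2 h ** A \<in> SL2 \<inter> ball (mat 1) \<delta>"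
    using compact_cover_translates[OF K(1,2) d(1)] by metis
  define C where "C = (\<lambda>A. mact A x) ` V"
  have "closed C" unfolding C_def using compact_orbit[OF V] by (rule compact_imp_closed)
  then have cl: "closed (mact h ` C)" if "h \<in> F" for h using F that by (intro closed_mact_image) auto
  have "(\<Union>h\<in>F. mact h ` C) = UNIV"
  proof (intro equalityI subset_UNIV subsetI)
    fix w :: 'x
    obtain A where A: "A \<in> K" "w = mact A x" using K(3) by blast
    then obtain h where h: "h \<in> F" "adj2 h ** A \<in> SL2 \<inter> ball (mat 1) \<delta>" using F by blast
    have "w = mact h (mact (adj2 h ** A) x)"
      using A h F K by (simp add: mact_mult subset_iff)
    moreover have "adj2 h ** A \<in> V" using h by (simp add: V_def)
    ultimately show "w \<in> (\<Union>h\<in>F. mact h ` C)" using h unfolding C_def by blast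
  qed
  then obtain h where h: "h \<in> F" "interior (mact h ` C) \<noteq> {}"
    using finite_closed_cover_interior[OF F(1), of "\<lambda>h. mact h ` C"] cl by metis
  have hS: "h \<in> SL2" using h F by auto
  obtain p where p: "p \<in> interior (mact h ` C)" using h by auto
  \<comment> \<open>An open part of Vx itself, obtained by undoing the translation by
    \<open>h\<close>.\<close>
  define Q where "Q = mact (adj2 h) ` interior (mact h ` C)"
  have oQ: "open Q" unfolding Q_def using hS by (intro open_mact_image) auto
  have QC: "Q \<subseteq> C"
  proof
    fix y assume "y \<in> Q"
    then obtain w where "w \<in> mact h ` C" "y = mact (adj2 h) w" unfolding Q_def using interior_subset by blast
    then show "y \<in> C" using hS by auto
  qed
  have "mact (adj2 h) p \<in> Q" using p unfolding Q_def by blast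
  then obtain v where v: "v \<in> V" "mact v x \<in> Q" using QC unfolding C_def by auto
  have vS: "v \<in> SL2" using v V by auto
  have "open (mact (adj2 v) ` Q)" using vS oQ by (intro open_mact_image) auto
  moreover have "x \<in> mact (adj2 v) ` Q" using v vS by (intro image_eqI[of _ _ "mact v x"]) auto
  moreover have "mact (adj2 v) ` Q \<subseteq> (\<lambda>A. mact A x) ` (SL2 \<inter> ball (mat 1) \<epsilon>)"
  proof
    fix y assume "y \<in> mact (adj2 v) ` Q"
    then obtain w where w: "w \<in> V" "y = mact (adj2 v) (mact w x)" using QC unfolding C_def by auto
    have "y = mact (adj2 v ** w) x" using w vS V by (auto simp: mact_mult subset_iff)
    moreover have "adj2 v ** w \<in> SL2 \<inter> ball (mat 1) \<epsilon>"
      using d(2)[of v w] v w vS V by (auto simp: V_def dist_norm norm_minus_commute)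
    ultimately show "y \<in> (\<lambda>A. mact A x) ` (SL2 \<inter> ball (mat 1) \<epsilon>)" by blast
  qed
  ultimately show ?thesis by (rule interiorI)
qed

text \<open>The neighbourhood \<open>U\<close> of x consists of points Ax with A near 1. If it meets
  its image under a^m, then Ax = a^m Bx, so A^-1 a^m B fixes x.\<close>

lemma stab_recurrent:
  assumes sob: "qualitative_sobolev act \<mu>" and conn: "connected (UNIV :: 'x set)"
  shows "recurrent_along_diagonal (stab x)"
  unfolding recurrent_along_diagonal_def
proof (intro allI impI)
  fix \<epsilon> :: real and N :: nat assume e: "\<epsilon> > 0"
  interpret mu: prob_space \<mu> by (rule prob_mu)
  define D :: "nat \<Rightarrow> real^2^2" where "D m = mat2 (2 ^ m) 0 0 (1 / 2 ^ m)" for m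
  have DS: "D m \<in> SL2" for m by (simp add: D_def SL2_iff)
  have DD: "D i ** D j = D (i + j)" for i j by (simp add: D_def matrix2_eq_iff power_add)
  define U where "U = interior ((\<lambda>A. mact A x) ` (SL2 \<inter> ball (mat 1) \<epsilon>))"
  have U: "open U" "x \<in> U" unfolding U_def using sobolev_orbit_nhd[OF sob conn e] by auto
  then have "emeasure \<mu> U > 0" by (intro full_support) auto
  then have mpos: "measure \<mu> U > 0" by (simp add: mu.emeasure_eq_measure)
  \<comment> \<open>Only multiples of \<open>M\<close> serve as times, so two distinct times differ
    by more than \<open>N\<close>.\<close>
  define M where "M = Suc N"
  define T where "T j = mact (D (j * M)) ` U" for j
  have oT: "open (T j)" for j unfolding T_def using DS U by (intro open_mact_image)
  have mT: "measure \<mu> (T j) = measure \<mu> U" for j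
    unfolding T_def measure_def using U by (simp add: emeasure_mact_image)
  \<comment> \<open>Recurrence in pigeonhole form: more than 1/\<mu>(U) disjoint sets of measure
    \<mu>(U) do not fit into a probability space.\<close>
  have "\<exists>i j. i < j \<and> T i \<inter> T j \<noteq> {}"
  proof (rule ccontr)
    assume no: "\<not> ?thesis"
    obtain n :: nat where n: "1 / measure \<mu> U < n" using reals_Archimedean2 by blast
    have "disjoint_family_on T {..<n}"
      unfolding disjoint_family_on_def using no by (metis inf_commute linorder_neqE_nat)
    then have "measure \<mu> (\<Union>j\<in>{..<n}. T j) = (\<Sum>j<n. measure \<mu> (T j))"
      using oT by (intro mu.finite_measure_finite_Union) (auto simp: sets_mu)
    also have "\<dots> = real n * measure \<mu> U" by (simp add: mT)
    also have "\<dots> > 1" using n mpos by (simp add: field_simps)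
    finally show False using mu.prob_le_1[of "\<Union>j\<in>{..<n}. T j"] by simp
  qed
  then obtain i j z where ij: "i < j" "z \<in> T i" "z \<in> T j" by blast
  obtain u w where u: "u \<in> U" "z = mact (D (i * M)) u" and w: "w \<in> U" "z = mact (D (j * M)) w"
    using ij unfolding T_def by blast
  obtain A where A: "A \<in> SL2 \<inter> ball (mat 1) \<epsilon>" "u = mact A x"
    using u(1) unfolding U_def using interior_subset by blast
  obtain B where B: "B \<in> SL2 \<inter> ball (mat 1) \<epsilon>" "w = mact B x"
    using w(1) unfolding U_def using interior_subset by blast
  define m where "m = (j - i) * M"
  have mN: "m \<ge> N"
  proof -
    have "1 * M \<le> (j - i) * M" using ij by (intro mult_le_mono1) auto
    then show ?thesis by (simp add: m_def M_def)
  qed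
  have jm: "D (j * M) = D (i * M) ** D m"
    using ij by (simp add: DD m_def add_mult_distrib[symmetric])
  have "mact (D (i * M)) u = mact (D (i * M)) (mact (D m) w)"
    using u w DS by (simp add: jm mact_mult)
  then have "u = mact (D m) w" using DS by (metis mact_adj2(1))
  then have "mact (adj2 A ** D m ** B) x = x"
    using A B DS by (simp add: mact_mult) (metis mact_adj2(1))
  then have "adj2 A ** D m ** B \<in> stab x" using A B DS by (simp add: stab_def)
  moreover have "norm (adj2 A - mat 1) < \<epsilon>" "norm (B - mat 1) < \<epsilon>"
    using A B unfolding norm_adj2_diff_one by (auto simp: dist_norm norm_minus_commute)
  ultimately show "\<exists>u\<in>SL2. \<exists>v\<in>SL2. \<exists>m\<ge>N. norm (u - mat 1) < \<epsilon> \<and> norm (v - mat 1) < \<epsilon> \<and> u ** mat2 (2 ^ m) 0 0 (1 / 2 ^ m) ** v \<in> stab x"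
    using A B mN unfolding D_def by (intro bexI[of _ "adj2 A"] bexI[of _ B] exI[of _ m]) auto
qed

lemma sobolev_point_or_discrete:
  assumes sob: "qualitative_sobolev act \<mu>" and conn: "connected (UNIV :: 'x set)"
  shows "(\<forall>y. y = x) \<or> (\<exists>\<epsilon>>0. \<forall>\<gamma>\<in>stab x. norm (\<gamma> - mat 1) < \<epsilon> \<longrightarrow> \<gamma> = mat 1)"
proof (rule disjCI)
  assume nd: "\<not> (\<exists>\<epsilon>>0. \<forall>\<gamma>\<in>stab x. norm (\<gamma> - mat 1) < \<epsilon> \<longrightarrow> \<gamma> = mat 1)"
  have st: "stab x = SL2"
  proof (rule SL2_subgroup_full_of_nondiscrete[OF stab_subgroup stab_closed])
    \<comment> \<open>Conjugates are stabilisers of other points, and recurrence holds at every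
      point.\<close>
    show "recurrent_along_diagonal (conj_set h (stab x))" if "h \<in> SL2" for h
      using that stab_recurrent[OF sob conn] by (simp add: conj_set_stab)
    show "\<exists>\<gamma>\<in>stab x. \<gamma> \<noteq> mat 1 \<and> norm (\<gamma> - mat 1) < \<epsilon>" if "\<epsilon> > 0" for \<epsilon>
      using nd that by blast
  qed
  show "\<forall>y. y = x"
  proof
    fix y
    obtain A where "A \<in> SL2" "y = mact A x" using sobolev_transitive[OF sob conn] by metis
    then show "y = x" using st by (auto simp: stab_def)
  qed
qed

lemma sobolev_iso_to_coset_space:
  assumes sob: "qualitative_sobolev act \<mu>" and conn: "connected (UNIV :: 'x set)"
  shows "iso_to_coset_space {g. act g x = x} act"
proof -
  let ?\<Gamma> = "{g. act g x = x}"
  \<comment> \<open>The inverse makes the cosets \<Gamma>k the fibres: replacing k by \<gamma>k puts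
    \<gamma>^-1 next to the point x that it fixes.\<close>
  define F where "F k = act (psl2_inv k) x" for k
  have cF: "continuous_on UNIV F"
    unfolding F_def
    using continuous_on_compose2[OF continuous_act_inv continuous_on_Pair[OF continuous_on_id continuous_on_const[of UNIV x]]]
    by simp
  have surjF: "range F = UNIV"
  proof (intro equalityI subset_UNIV subsetI)
    fix y
    obtain A where A: "A \<in> SL2" "y = mact A x" using sobolev_transitive[OF sob conn] by metis
    then have "y = F (psl2_of (adj2 A))" by (simp add: F_def mact_def)
    then show "y \<in> range F" by blast
  qed
  have openF: "open (F ` U)" if U: "open U" for U
  proof (rule topological_space_class.openI)
    fix y assume "y \<in> F ` U"
    then obtain k where k: "k \<in> U" "y = F k" by auto
    obtain B where B: "B \<in> SL2" "k = psl2_of B" by (rule psl2_cases)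
    \<comment> \<open>For y = F k one has Ay = F(k A^-1), and k A^-1 stays in \<open>U\<close> for A
      near 1. So the image contains the points Ay with A small, which form a neighbourhood of
      y.\<close>
    have c: "continuous_on SL2 (\<lambda>A. psl2_of (B ** adj2 A))"
      using B by (intro continuous_on_compose2[OF continuous_on_psl2_of] continuous_intros) auto
    have "openin (top_of_set SL2) (SL2 \<inter> (\<lambda>A. psl2_of (B ** adj2 A)) -` U)"
      by (rule continuous_openin_preimage_gen[OF c U])
    then obtain T where T: "open T" "SL2 \<inter> (\<lambda>A. psl2_of (B ** adj2 A)) -` U = SL2 \<inter> T"
      by (auto simp: openin_open)
    have "mat 1 \<in> SL2 \<inter> (\<lambda>A. psl2_of (B ** adj2 A)) -` U" using k B by simp
    then have "mat 1 \<in> T" using T by blast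
    then obtain \<epsilon> where e: "\<epsilon> > 0" "ball (mat 1) \<epsilon> \<subseteq> T" using T(1) open_contains_ball by blast
    have "(\<lambda>A. mact A y) ` (SL2 \<inter> ball (mat 1) \<epsilon>) \<subseteq> F ` U"
    proof
      fix w assume "w \<in> (\<lambda>A. mact A y) ` (SL2 \<inter> ball (mat 1) \<epsilon>)"
      then obtain A where A: "A \<in> SL2" "A \<in> ball (mat 1) \<epsilon>" "w = mact A y" by auto
      have "w = F (psl2_of (B ** adj2 A))"
        using A k B by (simp add: F_def mact_def adj2_matrix_mult act_mult[symmetric])
      moreover have "psl2_of (B ** adj2 A) \<in> U" using A e T by blast
      ultimately show "w \<in> F ` U" by blast
    qed
    then have "y \<in> interior (F ` U)"
      using sobolev_orbit_nhd[OF sob conn e(1), of y] interior_mono by blast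
    then show "\<exists>T. open T \<and> y \<in> T \<and> T \<subseteq> F ` U" using interior_subset open_interior by blast
  qed
  have quot: "quotient_map euclidean euclidean F"
    by (rule continuous_open_imp_quotient_map)
      (use cF openF surjF in \<open>auto simp: open_map_def continuous_map_iff_continuous2\<close>)
  have inv: "act (psl2_inv g) x = x" if "act g x = x" for g
  proof -
    have "act (psl2_inv g) (act g x) = x" by (simp add: act_mult[symmetric])
    then show ?thesis using that by simp
  qed
  have fib: "F k = F k' \<longleftrightarrow> psl2_rcoset ?\<Gamma> k = psl2_rcoset ?\<Gamma> k'" for k k'
  proof
    assume eq: "F k = F k'"
    have sub: "psl2_rcoset ?\<Gamma> k \<subseteq> psl2_rcoset ?\<Gamma> k'" if eq: "F k = F k'" for k k'
    proof
      fix z assume "z \<in> psl2_rcoset ?\<Gamma> k"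
      then obtain g where g: "act g x = x" "z = g * k" by (auto simp: psl2_rcoset_def)
      have "act (k * psl2_inv k') x = act k (act (psl2_inv k) x)"
        using eq by (simp add: F_def act_mult)
      also have "\<dots> = x" by (simp add: act_mult[symmetric])
      finally have "act (g * (k * psl2_inv k')) x = x" using g by (simp add: act_mult)
      moreover have "z = (g * (k * psl2_inv k')) * k'" using g by (simp add: psl2_mult_assoc)
      ultimately show "z \<in> psl2_rcoset ?\<Gamma> k'" unfolding psl2_rcoset_def by blast
    qed
    show "psl2_rcoset ?\<Gamma> k = psl2_rcoset ?\<Gamma> k'" using sub[OF eq] sub[OF eq[symmetric]] by blast
  next
    assume eq: "psl2_rcoset ?\<Gamma> k = psl2_rcoset ?\<Gamma> k'"
    have "k \<in> psl2_rcoset ?\<Gamma> k" unfolding psl2_rcoset_def by (intro image_eqI[of _ _ 1]) auto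
    then obtain g where g: "act g x = x" "k = g * k'" using eq by (auto simp: psl2_rcoset_def)
    then show "F k = F k'" using inv[OF g(1)] by (simp add: F_def psl2_inv_times act_mult)
  qed
  have equi: "F (k * psl2_inv g) = act g (F k)" for g k
    by (simp add: F_def psl2_inv_times act_mult)
  show ?thesis unfolding iso_to_coset_space_def using quot fib equi by blast
qed

lemma sobolev_cocompact_lattice:
  assumes sob: "qualitative_sobolev act \<mu>" and conn: "connected (UNIV :: 'x set)"
    and e: "\<epsilon> > 0" "\<And>\<gamma>. \<gamma> \<in> stab x \<Longrightarrow> norm (\<gamma> - mat 1) < \<epsilon> \<Longrightarrow> \<gamma> = mat 1"
  shows "cocompact_lattice {g. act g x = x}"
  unfolding cocompact_lattice_def
proof (intro conjI ballI)
  show "1 \<in> {g. act g x = x}" by simp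
  show "a * b \<in> {g. act g x = x}" if "a \<in> {g. act g x = x}" "b \<in> {g. act g x = x}" for a b
    using that by (simp add: act_mult)
  show "psl2_inv a \<in> {g. act g x = x}" if "a \<in> {g. act g x = x}" for a
  proof -
    have "act (psl2_inv a) (act a x) = x" by (simp add: act_mult[symmetric])
    then show ?thesis using that by simp
  qed
  show "\<exists>U. open U \<and> 1 \<in> U \<and> U \<inter> {g. act g x = x} = {1}"
  proof (intro exI conjI)
    let ?U = "psl2_of ` (SL2 \<inter> ball (mat 1) \<epsilon>)"
    show "open ?U" by (intro open_psl2_of_image) simp
    show one: "1 \<in> ?U" unfolding one_psl2_def using e by (intro imageI) simp
    have "g = 1" if g: "g \<in> ?U" "act g x = x" for g
    proof -
      obtain A where A: "A \<in> SL2" "A \<in> ball (mat 1) \<epsilon>" "g = psl2_of A" using g(1) by blast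
      then have "A \<in> stab x" using g by (simp add: stab_def mact_def)
      then have "A = mat 1" using A by (intro e(2)) (auto simp: dist_norm norm_minus_commute)
      then show ?thesis using A by (simp add: one_psl2_def)
    qed
    then show "?U \<inter> {g. act g x = x} = {1}" using one by auto
  qed
  show "\<exists>K. compact K \<and> (\<forall>g. \<exists>\<gamma>\<in>{g. act g x = x}. \<exists>c\<in>K. g = \<gamma> * c)"
  proof -
    obtain K where K: "compact K" "K \<subseteq> SL2" "(\<lambda>A. mact A x) ` K = UNIV"
      using sobolev_compact_orbit[OF sob conn] by metis
    \<comment> \<open>The inverses of \<open>K\<close> are needed: if C in \<open>K\<close> moves x
      to g^-1 x, then gC fixes x and g = (gC) C^-1.\<close>
    have "compact (psl2_of ` adj2 ` K)"
      using K by (intro compact_continuous_image continuous_on_subset[OF continuous_on_psl2_of] continuous_intros) auto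
    moreover have "\<exists>\<gamma>\<in>{g. act g x = x}. \<exists>c\<in>psl2_of ` adj2 ` K. g = \<gamma> * c" for g
    proof -
      obtain C where C: "C \<in> K" "act (psl2_inv g) x = mact C x" using K(3) by blast
      have CS: "C \<in> SL2" using C K by auto
      have "act (g * psl2_of C) x = act g (act (psl2_inv g) x)"
        using C by (simp add: act_mult mact_def)
      also have "\<dots> = x" by (simp add: act_mult[symmetric])
      finally have "g * psl2_of C \<in> {g. act g x = x}" by simp
      moreover have "g = (g * psl2_of C) * psl2_of (adj2 C)"
        using CS by (simp add: psl2_mult_assoc one_psl2_def[symmetric])
      ultimately show ?thesis using C by blast
    qed
    ultimately show ?thesis by blast
  qed
qed

end

theorem theorem11p3:
  fixes act :: "psl2 \<Rightarrow> 'x::t2_space \<Rightarrow> 'x"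
    and \<mu> :: "'x measure"
  assumes "G_space act"
    and "connected (UNIV :: 'x set)"
    and "prob_space \<mu>"
    and "sets \<mu> = sets borel"
    and "\<forall>g A. A \<in> sets borel \<longrightarrow> emeasure \<mu> (act g ` A) = emeasure \<mu> A"
    and "\<forall>U. open U \<and> U \<noteq> {} \<longrightarrow> emeasure \<mu> U > 0"
    and "qualitative_sobolev act \<mu>"
  shows "(\<exists>x0. \<forall>x::'x. x = x0) \<or> (\<exists>\<Gamma>. cocompact_lattice \<Gamma> \<and> iso_to_coset_space \<Gamma> act)"
proof -
  interpret psl2_prob_space act \<mu>
    using assms(1,3-6) by (intro psl2_prob_space.intro psl2_space.intro psl2_prob_space_axioms.intro) simp_all
  \<comment> \<open>Types are inhabited, so an arbitrary base point is available.\<close>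
  fix x :: 'x
  consider "\<forall>y. y = x" | \<epsilon> where "\<epsilon> > 0" "\<And>\<gamma>. \<gamma> \<in> stab x \<Longrightarrow> norm (\<gamma> - mat 1) < \<epsilon> \<Longrightarrow> \<gamma> = mat 1"
    using sobolev_point_or_discrete[OF assms(7,2), of x] by blast
  then show ?thesis
  proof cases
    case 1
    then show ?thesis by blast
  next
    case 2
    then have "cocompact_lattice {g. act g x = x}"
      by (rule sobolev_cocompact_lattice[OF assms(7,2)])
    then show ?thesis using sobolev_iso_to_coset_space[OF assms(7,2)] by blast
  qed
qed

end
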